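(* Let $c:\mathbb{N}\to\mathbb{R}_+$. Suppose that for every number of agents $k$ there is an asynchronous collective tree exploration (ACTE) algorithm with $k$ agents that explores any tree with $n$ nodes and depth $D$ in at most $\mathcal{O}(c(k)(n+kD))$ moves (with a constant in $\mathcal{O}(\cdot)$ independent of $k,n,D$). Then $c(k)=\Omega(\log^2 k)$.
   Context: ACTE model. An unknown finite rooted tree is to be explored by $k$ agents, all initially located at the root. Exploration proceeds in rounds; at each round an omniscient adversary (knowing the algorithm, the tree, and the state of all agents) selects one agent, which (1) observes the nodes adjacent to its position, (2) takes part in one round of unrestricted all-to-all communication with all other agents (so the team may be controlled centrally), and (3) moves along an edge to a neighbouring node. Each round counts as one move. A node is visited once an agent located at it has been activated; exploration finishes at the first round at which all nodes are visited. An algorithm explores a tree in at most $M$ moves if, against every adversary, exploration finishes within $M$ rounds. The depth is the maximum distance from the root to a node. The lower bound applies a fortiori to the distributed model where communication is only through whiteboards at nodes. *)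

theory Defs
  imports Complex_Main "HOL-Library.Landau_Symbols"
begin

(* Arcs are oriented from parent to child. Nodes carry arbitrary natural-number labels; an
   algorithm has to cope with every labelling, so labels tell it nothing about unseen nodes. *)
record rtree =
  nodes :: "nat set"
  tree_root :: nat
  arcs :: "(nat \<times> nat) set"

definition rooted_tree :: "rtree \<Rightarrow> bool" where
  "rooted_tree T \<longleftrightarrow>
     finite (nodes T) \<and> tree_root T \<in> nodes T \<and> arcs T \<subseteq> nodes T \<times> nodes T \<and>
     (\<forall>v. (v, tree_root T) \<notin> arcs T) \<and> single_valued ((arcs T)\<inverse>) \<and>
     (\<forall>v\<in>nodes T. (tree_root T, v) \<in> (arcs T)\<^sup>*)"

definition adj :: "rtree \<Rightarrow> (nat \<times> nat) set" where
  "adj T = arcs T \<union> (arcs T)\<inverse>"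

definition neighbours :: "rtree \<Rightarrow> nat \<Rightarrow> nat set" where
  "neighbours T v = adj T `` {v}"

definition dist_root :: "rtree \<Rightarrow> nat \<Rightarrow> nat" where
  "dist_root T v = (LEAST d. (tree_root T, v) \<in> adj T ^^ d)"

definition depth :: "rtree \<Rightarrow> nat" where
  "depth T = Max (dist_root T ` nodes T)"

(* One entry per round, oldest first: the activated agent, the node where it is activated, and
   the set of neighbours it observes there. *)
type_synonym history = "(nat \<times> nat \<times> nat set) list"

(* Past observations together with the current positions of all agents. *)
type_synonym config = "history \<times> (nat \<Rightarrow> nat)"

(* Maps the shared knowledge of the team, including the observation just made by the activated
   agent (the last entry), to the node which this agent moves to. Earlier moves are not recorded
   since they are determined by the algorithm and earlier entries. *)
type_synonym algorithm = "history \<Rightarrow> nat"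

definition legal :: "algorithm \<Rightarrow> bool" where
  "legal A \<longleftrightarrow> (\<forall>h i p N. N \<noteq> {} \<longrightarrow> A (h @ [(i, p, N)]) \<in> N)"

(* Omniscience of the adversary: it is chosen after the algorithm and the tree, and it sees the
   whole configuration. *)
type_synonym adversary = "config \<Rightarrow> nat"

definition adversary_for :: "nat \<Rightarrow> adversary \<Rightarrow> bool" where
  "adversary_for k adv \<longleftrightarrow> (\<forall>s. adv s < k)"

(* An agent activated at a node without neighbours (one-node tree) has no edge to take and
   stays where it is. *)
definition step :: "algorithm \<Rightarrow> rtree \<Rightarrow> adversary \<Rightarrow> config \<Rightarrow> config" where
  "step A T adv s =
     (let (h, pos) = s;
          i = adv s;
          N = neighbours T (pos i);
          h' = h @ [(i, pos i, N)]
      in (h', if N = {} then pos else pos(i := A h')))"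

primrec run :: "algorithm \<Rightarrow> rtree \<Rightarrow> adversary \<Rightarrow> nat \<Rightarrow> config" where
  "run A T adv 0 = ([], \<lambda>_. tree_root T)"
| "run A T adv (Suc t) = step A T adv (run A T adv t)"

definition visited :: "config \<Rightarrow> nat set" where
  "visited s = {p. \<exists>i N. (i, p, N) \<in> set (fst s)}"

definition explores_within :: "algorithm \<Rightarrow> nat \<Rightarrow> rtree \<Rightarrow> real \<Rightarrow> bool" where
  "explores_within A k T M \<longleftrightarrow>
     (\<forall>adv. adversary_for k adv \<longrightarrow>
        (\<exists>t. real t \<le> M \<and> nodes T \<subseteq> visited (run A T adv t)))"

end

theory Submission imports Defs "HOL-Library.Countable" "HOL-Library.Sublist" begin

text \<open>
  The adversary reveals the tree while the algorithm runs, as in the lower bound for layered graph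
  traversal. It maintains a set of live leaves on which all agents wait. To move on, it extends some
  of them or declares some of them dead, and then activates agents off the live leaves until all
  agents are on live leaves again; the number of moves is at least the sum of the distances
  travelled.

  By recursion on \<open>w\<close>, gadgets of depth \<open>d\<close> are built for which every agent pays \<open>c\<close>. A gadget of
  the next level forks into two arms that are chains of gadgets of the current level. First both
  arms grow in parallel, each copying the other, until they are \<open>3 * c\<close> apart; after that, changing
  the arm never pays off within one gadget. Then the arms race: in each step the adversary extends
  the arm that is worse for the team, which costs each agent \<open>c / 2\<close> on average. The race ends
  after at most \<open>2 * r\<^sup>2\<close> steps or at a difference of \<open>r\<close>; the longer arm is killed and
  the shorter one is extended to its final length \<open>m\<close>. Since a random walk of \<open>r\<^sup>2\<close> steps
  deviates by about \<open>r\<close>, an agent pays for \<open>m + r / 4\<close> copies instead of \<open>m\<close>. With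
  \<open>r\<^sup>2\<close> and \<open>m\<close> of order \<open>R = c / d\<close>, the ratio \<open>R\<close> grows by order \<open>sqrt R\<close> per
  level, hence \<open>R\<close> is of order \<open>w\<^sup>2\<close>, while the number of nodes per unit of depth only
  doubles. So \<open>w\<close> can be taken as the binary logarithm of \<open>k\<close>.
\<close>

section \<open>Trees of binary words\<close>

text \<open>This is the graph distance in the infinite binary tree whose nodes are the words over
  \<open>bool\<close>; the path between two words passes through their longest common
  prefix.\<close>

fun tdist :: "bool list \<Rightarrow> bool list \<Rightarrow> nat" where
  "tdist [] v = length v"
| "tdist u [] = length u"
| "tdist (a # u) (b # v) = (if a = b then tdist u v else 2 + length u + length v)"

lemma tdist_Nil2 [simp]: "tdist u [] = length u"
  by (cases u) auto

lemma tdist_refl [simp]: "tdist u u = 0"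
  by (induction u) auto

lemma tdist_commute: "tdist u v = tdist v u"
  by (induction u v rule: tdist.induct) auto

lemma tdist_eq_0: "tdist u v = 0 \<longleftrightarrow> u = v"
  by (induction u v rule: tdist.induct) auto

lemma tdist_le_Suc_snoc: "tdist x u \<le> Suc (tdist x (u @ [b]))"
  by (induction x u rule: tdist.induct) (auto split: if_splits)

lemma tdist_snoc_le_Suc: "tdist x (u @ [b]) \<le> Suc (tdist x u)"
  by (induction x u rule: tdist.induct) (auto split: if_splits)

lemma tdist_append:
  assumes "\<not> prefix e v" "\<not> prefix v e"
  shows "tdist e (v @ u) = tdist e v + length u"
  using assms by (induction e v rule: tdist.induct) auto

definition prefix_closed :: "bool list set \<Rightarrow> bool" where
  "prefix_closed S \<longleftrightarrow> [] \<in> S \<and> (\<forall>u b. u @ [b] \<in> S \<longrightarrow> u \<in> S)"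

text \<open>Labels are codes of words and do not depend on \<open>S\<close>, so a node keeps its
  label when the adversary enlarges the tree and recorded observations stay meaningful.\<close>

definition word_tree :: "bool list set \<Rightarrow> rtree" where
  "word_tree S = \<lparr>nodes = to_nat ` S, tree_root = to_nat ([] :: bool list),
     arcs = {(to_nat u, to_nat (u @ [b])) | u b. u @ [b] \<in> S}\<rparr>"

lemma prefix_closedD: "prefix_closed S \<Longrightarrow> u @ v \<in> S \<Longrightarrow> u \<in> S"
proof (induction v rule: rev_induct)
  case (snoc x xs)
  then show ?case
    unfolding prefix_closed_def by (metis append_assoc)
qed simp

lemma neighbours_word_tree:
  "neighbours (word_tree S) (to_nat u) =
     to_nat ` ({u @ [b] |b. u @ [b] \<in> S} \<union> {p. \<exists>b. u = p @ [b] \<and> u \<in> S})"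
  by (auto simp: neighbours_def adj_def word_tree_def image_iff)

lemma word_tree_arcs_relpow:
  assumes "prefix_closed S" "u \<in> S"
  shows "(to_nat ([] :: bool list), to_nat u) \<in> (arcs (word_tree S)) ^^ length u"
  using assms(2)
proof (induction u rule: rev_induct)
  case Nil
  then show ?case by simp
next
  case (snoc b u)
  then have "u \<in> S" using assms(1) by (auto simp: prefix_closed_def)
  moreover have "(to_nat u, to_nat (u @ [b])) \<in> arcs (word_tree S)"
    using snoc.prems by (auto simp: word_tree_def)
  ultimately show ?case using snoc.IH by auto
qed

lemma rooted_tree_word_tree:
  assumes "finite S" "prefix_closed S"
  shows "rooted_tree (word_tree S)"
proof -
  have "\<forall>v\<in>nodes (word_tree S). (tree_root (word_tree S), v) \<in> (arcs (word_tree S))\<^sup>*"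
    using word_tree_arcs_relpow[OF assms(2)]
    by (auto simp: word_tree_def dest!: relpow_imp_rtrancl)
  moreover have "u \<in> S" if "u @ [b] \<in> S" for u b
    using that assms(2) by (auto simp: prefix_closed_def)
  ultimately show ?thesis
    using assms by (auto simp: rooted_tree_def word_tree_def prefix_closed_def single_valued_def)
qed

lemma depth_word_tree_le:
  assumes "finite S" "prefix_closed S" "\<And>u. u \<in> S \<Longrightarrow> length u \<le> H"
  shows "depth (word_tree S) \<le> H"
proof -
  have "dist_root (word_tree S) (to_nat u) \<le> length u" if "u \<in> S" for u
  proof -
    have "arcs (word_tree S) ^^ n \<subseteq> adj (word_tree S) ^^ n" for n
      by (induction n) (auto simp: adj_def)
    then show ?thesis
      using word_tree_arcs_relpow[OF assms(2) that] unfolding dist_root_def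
      by (intro Least_le) (auto simp: word_tree_def)
  qed
  then have "\<And>x. x \<in> dist_root (word_tree S) ` nodes (word_tree S) \<Longrightarrow> x \<le> H"
    using assms(3) by (fastforce simp: word_tree_def intro: order_trans)
  moreover have "nodes (word_tree S) \<noteq> {}" "finite (nodes (word_tree S))"
    using assms by (auto simp: word_tree_def prefix_closed_def)
  ultimately show ?thesis
    unfolding depth_def by (subst Max_le_iff) auto
qed

lemma card_word_tree: "card (nodes (word_tree S)) = card S"
  by (simp add: word_tree_def card_image)

section \<open>Adaptive adversaries\<close>

text \<open>Reachability by an arbitrary sequence of activations leaves the adversary open, so that
  it can be fixed after the tree has been grown step by step.\<close>

inductive reachable :: "algorithm \<Rightarrow> nat \<Rightarrow> rtree \<Rightarrow> config \<Rightarrow> bool" for A k T where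
  init: "reachable A k T ([], \<lambda>_. tree_root T)"
| activate: "reachable A k T s \<Longrightarrow> i < k \<Longrightarrow> reachable A k T (step A T (\<lambda>_. i) s)"

lemma length_fst_step [simp]: "length (fst (step A T adv s)) = Suc (length (fst s))"
  by (simp add: step_def Let_def split: prod.split)

lemma step_cong: "adv s = adv' s \<Longrightarrow> step A T adv s = step A T adv' s"
  by (simp add: step_def)

lemma visited_step: "visited (step A T adv s) = insert (snd s (adv s)) (visited s)"
  by (auto simp: step_def visited_def Let_def split: prod.split)

lemma length_fst_run [simp]: "length (fst (run A T adv t)) = t"
  by (induction t) auto

lemma visited_run_mono: "t \<le> t' \<Longrightarrow> visited (run A T adv t) \<subseteq> visited (run A T adv t')"
  by (rule lift_Suc_mono_le) (auto simp: visited_step)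

lemma reachable_run:
  assumes "adversary_for k adv"
  shows "reachable A k T (run A T adv t)"
proof (induction t)
  case 0
  show ?case by (simp add: reachable.init)
next
  case (Suc t)
  have "adv (run A T adv t) < k" using assms unfolding adversary_for_def by blast
  from reachable.activate[OF Suc this] show ?case
    by (simp cong: step_cong)
qed

text \<open>The length of the history tells the adversary the current round. It can therefore replay
  any given sequence of activations first and act as \<open>adv'\<close> afterwards.\<close>

lemma reachable_imp_run:
  assumes "reachable A k T s" "adversary_for k adv'"
  shows "\<exists>adv. adversary_for k adv \<and> run A T adv (length (fst s)) = s \<and>
           (\<forall>s'. length (fst s) \<le> length (fst s') \<longrightarrow> adv s' = adv' s')"
  using assms
proof (induction arbitrary: adv' rule: reachable.induct)
  case init
  then show ?case by auto
next
  case (activate s i)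
  let ?adv = "\<lambda>s'. if length (fst s') \<le> length (fst s) then i else adv' s'"
  have "adversary_for k ?adv"
    using activate.prems activate.hyps by (simp add: adversary_for_def)
  then obtain adv where adv: "adversary_for k adv" "run A T adv (length (fst s)) = s"
    "\<And>s'. length (fst s) \<le> length (fst s') \<Longrightarrow> adv s' = ?adv s'"
    using activate.IH by blast
  have "step A T adv s = step A T (\<lambda>_. i) s"
    by (rule step_cong) (simp add: adv(3))
  with adv show ?case by (intro exI[of _ adv]) auto
qed

text \<open>The algorithm has seen only the neighbourhoods of visited nodes. Changing the tree
  elsewhere does not alter the past, so the adversary may grow the tree during the run.\<close>

lemma reachable_cong:
  assumes "reachable A k T s" "tree_root T' = tree_root T"
    and "\<And>p. p \<in> visited s \<Longrightarrow> neighbours T' p = neighbours T p"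
  shows "reachable A k T' s"
  using assms(1,3)
proof (induction rule: reachable.induct)
  case init
  show ?case using reachable.init[of A k T'] by (simp add: assms(2))
next
  case (activate s i)
  have "step A T' (\<lambda>_. i) s = step A T (\<lambda>_. i) s"
    using activate.prems[of "snd s i"] unfolding visited_step
    by (cases s) (simp add: step_def)
  moreover have "reachable A k T' s"
    using activate.prems by (intro activate.IH) (simp add: visited_step)
  ultimately show ?case
    using reachable.activate[of A k T' s i] activate.hyps by simp
qed

section \<open>Live leaves and the potential\<close>

definition pos_word :: "config \<Rightarrow> nat \<Rightarrow> bool list" where
  "pos_word s i = from_nat (snd s i)"

text \<open>Only termination on every tree is assumed; it makes the activations of the adversary
  come to an end. The bound on the number of moves enters in \<open>expensive_tree\<close>.\<close>

locale explorer =
  fixes A :: algorithm and k :: nat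
  assumes legal: "legal A"
    and k_pos: "k \<ge> 1"
    and explores: "\<And>T adv. rooted_tree T \<Longrightarrow> adversary_for k adv \<Longrightarrow>
                     \<exists>t. nodes T \<subseteq> visited (run A T adv t)"
begin

lemma pos_step:
  assumes "snd s i \<in> to_nat ` S" "prefix_closed S"
  shows "snd (step A (word_tree S) adv s) i \<in> to_nat ` S"
    and "tdist x (pos_word (step A (word_tree S) adv s) i)
           \<le> tdist x (pos_word s i) + (if i = adv s then 1 else 0)"
proof -
  let ?s' = "step A (word_tree S) adv s"
  obtain u where u: "snd s i = to_nat u" "u \<in> S" using assms(1) by auto
  have *: "snd ?s' i = to_nat u \<or>
        i = adv s \<and> snd ?s' i \<in> neighbours (word_tree S) (to_nat u)"
  proof (cases s)
    case (Pair h pos)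
    have "N \<noteq> {} \<Longrightarrow> A (h @ [(i, p, N)]) \<in> N" for i p N
      using legal unfolding legal_def by blast
    then show ?thesis using u Pair
      by (cases "i = adv s"; cases "neighbours (word_tree S) (to_nat u) = {}")
        (auto simp: step_def Let_def)
  qed
  then show "snd ?s' i \<in> to_nat ` S"
    using u assms(2) by (auto simp: neighbours_word_tree prefix_closed_def)
  from * show "tdist x (pos_word ?s' i) \<le> tdist x (pos_word s i) + (if i = adv s then 1 else 0)"
  proof
    assume "i = adv s \<and> snd ?s' i \<in> neighbours (word_tree S) (to_nat u)"
    then show ?thesis
      using u tdist_le_Suc_snoc[of x] tdist_snoc_le_Suc[of x]
      by (auto simp: neighbours_word_tree pos_word_def)
  qed (simp add: pos_word_def u)
qed

text \<open>All agents wait on unvisited leaves, so the algorithm has not observed what is below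
  \<open>L\<close> and the tree may still be extended there. The bound \<open>H\<close> is kept for
  the depth of the final tree.\<close>

definition live_state :: "nat \<Rightarrow> bool list set \<Rightarrow> bool list set \<Rightarrow> config \<Rightarrow> bool" where
  "live_state H S L s \<longleftrightarrow>
     finite S \<and> prefix_closed S \<and> (\<forall>u\<in>S. length u \<le> H) \<and>
     L \<subseteq> S \<and> (\<forall>u\<in>L. \<forall>b. u @ [b] \<notin> S) \<and>
     reachable A k (word_tree S) s \<and> (\<forall>i<k. snd s i \<in> to_nat ` L) \<and>
     visited s \<subseteq> to_nat ` (S - L)"

text \<open>Moves already made plus an amount promised for each agent, depending on its position.
  The adversary never lets the sum decrease, so once the promises have dropped to 0 the initial ones
  have been paid in moves.\<close>

definition potential :: "config \<Rightarrow> (bool list \<Rightarrow> real) \<Rightarrow> real" where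
  "potential s f = real (length (fst s)) + (\<Sum>i<k. f (pos_word s i))"

text \<open>A proper extension of \<open>x\<close> in the prefix-closed \<open>S\<close> would give
  the leaf \<open>x\<close> a child.\<close>

lemma live_state_antichain:
  assumes "live_state H S L s" "x \<in> L" "y \<in> L" "prefix x y"
  shows "x = y"
proof (rule ccontr)
  assume "x \<noteq> y"
  with assms(4) obtain b z where "y = (x @ [b]) @ z"
    by (metis append.assoc append_Cons append_Nil append_Nil2 neq_Nil_conv prefix_def)
  moreover have "y \<in> S" "prefix_closed S" using assms by (auto simp: live_state_def)
  ultimately have "x @ [b] \<in> S" using prefix_closedD by blast
  then show False using assms by (auto simp: live_state_def)
qed

lemma live_state_tdist_append:
  assumes "live_state H S L s" "x \<in> L" "y \<in> L" "x \<noteq> y"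
  shows "tdist x (y @ u) = tdist x y + length u"
  using live_state_antichain[OF assms(1)] assms by (intro tdist_append) blast+

lemma pos_word_live: "live_state H S L s \<Longrightarrow> i < k \<Longrightarrow> pos_word s i \<in> L"
  by (fastforce simp: live_state_def pos_word_def)

lemma potential_mono:
  assumes "live_state H S L s" "\<And>x. x \<in> L \<Longrightarrow> f x \<le> g x"
  shows "potential s f \<le> potential s g"
  using assms pos_word_live[OF assms(1)] by (auto simp: potential_def intro!: sum_mono)

text \<open>The adversary keeps activating agents outside \<open>L'\<close>. This must end, since otherwise
  \<open>L'\<close> would never be visited.\<close>

lemma advance:
  assumes st: "live_state H S L s"
    and S': "finite S'" "prefix_closed S'" "\<And>u. u \<in> S' \<Longrightarrow> length u \<le> H" "S \<subseteq> S'"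
    and old: "\<And>u b. u \<in> S - L \<Longrightarrow> u @ [b] \<in> S' \<Longrightarrow> u @ [b] \<in> S"
    and L': "L' \<subseteq> S'" "L' \<noteq> {}" "L' \<inter> (S - L) = {}" "\<And>u b. u \<in> L' \<Longrightarrow> u @ [b] \<notin> S'"
    and fg: "\<And>x y. x \<in> L \<Longrightarrow> y \<in> L' \<Longrightarrow> f x \<le> g y + real (tdist x y)"
  shows "\<exists>s'. live_state H S' L' s' \<and> potential s f \<le> potential s' g"
proof -
  let ?T = "word_tree S'"
  let ?n = "length (fst s)"
  have vis: "visited s \<subseteq> to_nat ` (S - L)" and LS: "L \<subseteq> S" and S: "prefix_closed S"
    and r: "reachable A k (word_tree S) s" and posL: "\<forall>i<k. snd s i \<in> to_nat ` L"
    using st by (auto simp: live_state_def)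
  have "reachable A k ?T s"
  proof (rule reachable_cong[OF r])
    fix p assume "p \<in> visited s"
    then obtain u where u: "p = to_nat u" "u \<in> S - L" using vis by auto
    then have "u \<in> S'" "\<And>b. u @ [b] \<in> S' \<longleftrightarrow> u @ [b] \<in> S"
      using S'(4) old by auto
    then show "neighbours ?T p = neighbours (word_tree S) p"
      using u by (simp add: neighbours_word_tree)
  qed (simp add: word_tree_def)
  define off where "off = (\<lambda>(s :: config) i. i < k \<and> snd s i \<notin> to_nat ` L')"
  \<comment> \<open>The default 0 keeps the adversary valid when no agent is off \<open>L'\<close>;
    agent 0 exists by \<open>k_pos\<close>.\<close>
  define adv' where "adv' = (\<lambda>s. if \<exists>i. off s i then SOME i. off s i else 0)"
  have off: "off s (adv' s)" if "\<exists>i. off s i" for s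
    using someI_ex[OF that] that by (simp add: adv'_def)
  have "adversary_for k adv'"
    unfolding adversary_for_def
  proof
    fix s show "adv' s < k"
      using off[of s] k_pos by (cases "\<exists>i. off s i") (auto simp: off_def adv'_def)
  qed
  then obtain adv where adv: "adversary_for k adv" "run A ?T adv ?n = s"
    "\<And>s'. ?n \<le> length (fst s') \<Longrightarrow> adv s' = adv' s'"
    using reachable_imp_run[OF \<open>reachable A k ?T s\<close>] by blast
  let ?r = "\<lambda>t. run A ?T adv (?n + t)"
  have unvisited: "visited (?r t) \<inter> to_nat ` L' = {}"
    if "\<And>t'. t' < t \<Longrightarrow> \<exists>i. off (?r t') i" for t
    using that
  proof (induction t)
    case 0
    have "to_nat ` (S - L) \<inter> to_nat ` L' = {}" using L'(3) by auto
    then have "visited s \<inter> to_nat ` L' = {}" using vis by blast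
    then show ?case by (simp add: adv(2))
  next
    case (Suc t)
    have "off (?r t) (adv (?r t))" using off Suc.prems[of t] by (simp add: adv(3))
    then show ?case using Suc by (simp add: visited_step off_def)
  qed
  have "\<exists>t. \<not> (\<exists>i. off (?r t) i)"
  proof (rule ccontr)
    assume "\<not> ?thesis"
    then have *: "visited (?r t) \<inter> to_nat ` L' = {}" for t
      using unvisited by blast
    obtain t where "nodes ?T \<subseteq> visited (run A ?T adv t)"
      using explores rooted_tree_word_tree S' adv(1) by blast
    also have "\<dots> \<subseteq> visited (?r t)" by (rule visited_run_mono) simp
    finally show False using *[of t] L'(1,2) by (auto simp: word_tree_def)
  qed
  then obtain t where t: "\<not> (\<exists>i. off (?r t) i)" "\<And>t'. t' < t \<Longrightarrow> \<exists>i. off (?r t') i"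
    using exists_least_iff[of "\<lambda>t. \<not> (\<exists>i. off (?r t) i)"] by auto
  \<comment> \<open>One move changes the position of one agent by distance at most 1, so the number
    of moves is at least the sum of the distances between old and new positions.\<close>
  have inv: "(\<forall>i<k. snd (?r t) i \<in> to_nat ` S') \<and> visited (?r t) \<subseteq> to_nat ` S' \<and>
      (\<Sum>i<k. tdist (pos_word s i) (pos_word (?r t) i)) \<le> t" for t
  proof (induction t)
    case 0
    have "to_nat ` L \<subseteq> to_nat ` S'" "to_nat ` (S - L) \<subseteq> to_nat ` S'"
      using LS S'(4) by auto
    then show ?case using posL vis by (auto simp: adv(2))
  next
    case (Suc t)
    let ?i = "adv (?r t)"
    have i: "?i < k" using adv(1) unfolding adversary_for_def by blast
    have "(\<Sum>i<k. tdist (pos_word s i) (pos_word (?r (Suc t)) i))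
        \<le> (\<Sum>i<k. tdist (pos_word s i) (pos_word (?r t) i) + (if i = ?i then 1 else 0))"
      using Suc pos_step(2)[OF _ S'(2), of "?r t" _ _ adv] by (intro sum_mono) simp
    also have "\<dots> \<le> t + 1" using Suc i by (simp add: sum.distrib)
    finally show ?case using Suc pos_step(1)[OF _ S'(2), of "?r t" _ adv] i
      by (auto simp: visited_step)
  qed
  have live: "live_state H S' L' (?r t)"
    unfolding live_state_def
  proof (intro conjI)
    show "\<forall>i<k. snd (?r t) i \<in> to_nat ` L'" using t(1) by (auto simp: off_def)
    show "visited (?r t) \<subseteq> to_nat ` (S' - L')"
      using inv[of t] unvisited[of t] t(2) by blast
  qed (use S' L' reachable_run[OF adv(1)] in auto)
  have "(\<Sum>i<k. f (pos_word s i))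
      \<le> (\<Sum>i<k. g (pos_word (?r t) i) + real (tdist (pos_word s i) (pos_word (?r t) i)))"
    using pos_word_live[OF st] pos_word_live[OF live] by (intro sum_mono fg) auto
  also have "\<dots> = (\<Sum>i<k. g (pos_word (?r t) i))
      + real (\<Sum>i<k. tdist (pos_word s i) (pos_word (?r t) i))"
    by (simp add: sum.distrib)
  also have "\<dots> \<le> (\<Sum>i<k. g (pos_word (?r t) i)) + real t"
  proof -
    have "real (\<Sum>i<k. tdist (pos_word s i) (pos_word (?r t) i)) \<le> real t"
      using inv[of t] by (simp only: of_nat_le_iff)
    then show ?thesis by simp
  qed
  finally have "potential s f \<le> potential (?r t) g" by (simp add: potential_def)
  with live show ?thesis by blast
qed

text \<open>Here \<open>advance\<close> is used with new edges below \<open>V\<close>. The leaves in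
  \<open>V\<close> become inner nodes, so their agents must move on.\<close>

lemma grow:
  assumes st: "live_state H S L s" and V: "V \<subseteq> L" "V \<noteq> {}" "B \<noteq> {}"
    and H: "\<And>v. v \<in> V \<Longrightarrow> length v < H"
    and W: "W = {v @ [b] |v b. v \<in> V \<and> b \<in> B}"
    and fg: "\<And>x y. x \<in> L \<Longrightarrow> y \<in> L - V \<union> W \<Longrightarrow> f x \<le> g y + real (tdist x y)"
  shows "\<exists>s'. live_state H (S \<union> W) (L - V \<union> W) s' \<and>
           card (S \<union> W) \<le> card S + card V * card B \<and> potential s f \<le> potential s' g"
proof -
  have S: "finite S" "prefix_closed S" "\<And>u. u \<in> S \<Longrightarrow> length u \<le> H" "L \<subseteq> S"
    "\<And>u b. u \<in> L \<Longrightarrow> u @ [b] \<notin> S"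
    using st by (auto simp: live_state_def)
  have fin: "finite V" "finite B" using S(1,4) V(1) by (meson finite_subset finite)+
  have W': "W = (\<lambda>(v, b). v @ [b]) ` (V \<times> B)" by (auto simp: W)
  have "card W \<le> card V * card B"
    unfolding W' using fin by (metis card_cartesian_product card_image_le finite_cartesian_product)
  then have card: "card (S \<union> W) \<le> card S + card V * card B"
    using card_Un_le[of S W] by linarith
  have "\<exists>s'. live_state H (S \<union> W) (L - V \<union> W) s' \<and> potential s f \<le> potential s' g"
  proof (rule advance[OF st])
    show "finite (S \<union> W)" using S fin by (simp add: W')
    show "prefix_closed (S \<union> W)" using S V by (auto simp: prefix_closed_def W)
    show "length u \<le> H" if "u \<in> S \<union> W" for u using that S H by (auto simp: W Suc_le_eq)
    show "u @ [b] \<in> S" if "u \<in> S - L" "u @ [b] \<in> S \<union> W" for u b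
      using that V by (auto simp: W)
    show "L - V \<union> W \<subseteq> S \<union> W" "L - V \<union> W \<noteq> {}" using S V by (auto simp: W)
    show "(L - V \<union> W) \<inter> (S - L) = {}" using S V by (auto simp: W)
    show "u @ [b] \<notin> S \<union> W" if "u \<in> L - V \<union> W" for u b
    proof -
      have "v @ [b'] \<notin> S" if "v \<in> V" for v b' using that S(5) V(1) by blast
      moreover have "u \<in> S" if "u @ [b] \<in> S" for u b using S(2) that by (auto simp: prefix_closed_def)
      moreover have "V \<subseteq> S" using V(1) S(4) by blast
      ultimately show ?thesis using that S(5) unfolding W by blast
    qed
    show "f x \<le> g y + real (tdist x y)" if "x \<in> L" "y \<in> L - V \<union> W" for x y
      using fg that .
  qed simp
  with card show ?thesis by blast
qed

text \<open>Here \<open>advance\<close> is used with an unchanged tree: the leaves outside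
  \<open>L'\<close> are declared dead and have to be left.\<close>

lemma prune:
  assumes st: "live_state H S L s" and L': "L' \<subseteq> L" "L' \<noteq> {}"
    and fg: "\<And>x y. x \<in> L \<Longrightarrow> y \<in> L' \<Longrightarrow> f x \<le> g y + real (tdist x y)"
  shows "\<exists>s'. live_state H S L' s' \<and> potential s f \<le> potential s' g"
  by (rule advance[OF st]) (use st L' fg in \<open>auto simp: live_state_def\<close>)

text \<open>Summed over the agents, \<open>f\<close> is at most the mean of \<open>f1\<close> and
  \<open>f2\<close>, so one of the two is no worse for the adversary. This replaces a fair coin by a
  deterministic choice.\<close>

lemma potential_average:
  assumes "live_state H S L s" "\<And>x. x \<in> L \<Longrightarrow> 2 * f x \<le> f1 x + f2 x"
  shows "potential s f \<le> potential s f1 \<or> potential s f \<le> potential s f2"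
proof -
  have "(\<Sum>i<k. 2 * f (pos_word s i)) \<le> (\<Sum>i<k. f1 (pos_word s i) + f2 (pos_word s i))"
    using assms pos_word_live[OF assms(1)] by (intro sum_mono) auto
  then show ?thesis by (auto simp: potential_def sum.distrib sum_distrib_left[symmetric])
qed

lemma live_state_tdist_append2:
  assumes "live_state H S L s" "x \<in> L" "y \<in> L" "x \<noteq> y"
  shows "tdist (x @ u) (y @ w) = tdist x y + length u + length w"
proof -
  have *: "\<not> prefix x y" "\<not> prefix y x"
    using live_state_antichain[OF assms(1)] assms by blast+
  then have "\<not> prefix (y @ w) x" "\<not> prefix x (y @ w)"
    by (meson append_prefixD prefixI prefix_same_cases)+
  then have "tdist (y @ w) (x @ u) = tdist (y @ w) x + length u" by (rule tdist_append)
  also have "\<dots> = tdist x y + length w + length u"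
    using tdist_append[OF *] by (simp add: tdist_commute)
  finally show ?thesis by (simp add: tdist_commute)
qed

section \<open>Gadgets\<close>

definition grown :: "(bool list \<Rightarrow> bool list) \<Rightarrow> bool list set \<Rightarrow> bool list set" where
  "grown p V = (\<lambda>v. v @ p v) ` V"

lemma grown_grown: "grown p (grown q V) = grown (\<lambda>v. q v @ p (v @ q v)) V"
  by (auto simp: grown_def image_image)

lemma card_grown_le: "finite V \<Longrightarrow> card (grown p V) \<le> card V"
  by (simp add: grown_def card_image_le)

text \<open>The adversary can grow a copy of a tree of depth \<open>d\<close> with at most \<open>N\<close> edges below each
  live leaf in \<open>V\<close> such that one leaf of each copy stays alive and every agent on \<open>V\<close> pays \<open>c\<close>.
  Other live leaves must be so far away that fleeing there does not pay off.\<close>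

definition gadget :: "nat \<Rightarrow> real \<Rightarrow> nat \<Rightarrow> bool" where
  "gadget d c N \<longleftrightarrow> (\<forall>H S L s V f F.
     live_state H S L s \<longrightarrow> V \<subseteq> L \<longrightarrow> V \<noteq> {} \<longrightarrow>
     (\<forall>v\<in>V. f v = F \<and> length v + d \<le> H) \<longrightarrow>
     (\<forall>x\<in>L-V. \<forall>y\<in>L-V. f x \<le> f y + real (tdist x y)) \<longrightarrow>
     (\<forall>e\<in>L-V. \<forall>v\<in>V. \<bar>f e - F\<bar> + 2 * c \<le> real (tdist e v)) \<longrightarrow>
     (\<exists>S' s' p. (\<forall>v\<in>V. length (p v) = d) \<and> live_state H S' (L - V \<union> grown p V) s' \<and>
        card S' \<le> card S + card V * N \<and>
        potential s f \<le> potential s' (\<lambda>x. if x \<in> L - V then f x else F - c)))"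

text \<open>An agent that leaves \<open>V\<close> for a child crosses an edge, and the other live
  leaves are so far away that fleeing there gains nothing. The set \<open>B\<close> is a singleton
  for a path and all of \<open>bool\<close> for a fork.\<close>

lemma edge:
  assumes st: "live_state H S L s" and V: "V \<subseteq> L" "V \<noteq> {}" "B \<noteq> {}"
    and F: "\<And>v. v \<in> V \<Longrightarrow> f v = F \<and> length v + 1 \<le> H"
    and lip: "\<And>x y. x \<in> L - V \<Longrightarrow> y \<in> L - V \<Longrightarrow> f x \<le> f y + real (tdist x y)"
    and far: "\<And>e v. e \<in> L - V \<Longrightarrow> v \<in> V \<Longrightarrow> \<bar>f e - F\<bar> \<le> real (tdist e v)"
    and W: "W = {v @ [b] |v b. v \<in> V \<and> b \<in> B}"
  shows "\<exists>s'. live_state H (S \<union> W) (L - V \<union> W) s' \<and>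
           card (S \<union> W) \<le> card S + card V * card B \<and>
           potential s f \<le> potential s' (\<lambda>x. if x \<in> L - V then f x else F - 1)"
proof (rule grow[OF st V _ W])
  show "length v < H" if "v \<in> V" for v using F[OF that] by simp
  have LS: "L \<subseteq> S" and leaf: "\<And>u b. u \<in> L \<Longrightarrow> u @ [b] \<notin> S"
    using st by (auto simp: live_state_def)
  fix x y assume x: "x \<in> L" and y: "y \<in> L - V \<union> W"
  show "f x \<le> (if y \<in> L - V then f y else F - 1) + real (tdist x y)"
  proof (cases "y \<in> L - V")
    case True
    have "f x \<le> f y + real (tdist x y)"
    proof (cases "x \<in> V")
      case x': True
      have "\<bar>f y - f x\<bar> \<le> real (tdist x y)"
        using far[OF True x'] F[OF x'] tdist_commute[of x y] by simp
      then show ?thesis by linarith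
    next
      case False
      then show ?thesis using lip[of x y] True x by simp
    qed
    then show ?thesis using True by simp
  next
    case False
    with y obtain v b where v: "y = v @ [b]" "v \<in> V" by (auto simp: W)
    show ?thesis
    proof (cases "x \<in> V")
      case True
      have "x \<in> S" "y \<notin> S" using x v leaf[of v b] V(1) LS by auto
      then have "tdist x y \<noteq> 0" by (auto simp: tdist_eq_0)
      then have "1 \<le> real (tdist x y)" by linarith
      moreover have "f x = F" using F[OF True] by blast
      ultimately show ?thesis unfolding if_not_P[OF False] by linarith
    next
      case x': False
      have "v \<in> L" "x \<noteq> v" using v V(1) x' by auto
      then have "tdist x y = tdist x v + 1"
        using live_state_tdist_append[OF st x, of v "[b]"] v by simp
      moreover have "\<bar>f x - F\<bar> \<le> real (tdist x v)" using far x x' v(2) by blast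
      ultimately show ?thesis unfolding if_not_P[OF False] by simp
    qed
  qed
qed

lemma gadget_edge: "gadget 1 1 1"
  unfolding gadget_def
proof (intro allI impI)
  fix H S L s V f and F :: real
  assume st: "live_state H S L s" and V: "V \<subseteq> L" "V \<noteq> {}"
    and F: "\<forall>v\<in>V. f v = F \<and> length v + 1 \<le> H"
    and lip: "\<forall>x\<in>L-V. \<forall>y\<in>L-V. f x \<le> f y + real (tdist x y)"
    and far: "\<forall>e\<in>L-V. \<forall>v\<in>V. \<bar>f e - F\<bar> + 2 * 1 \<le> real (tdist e v)"
  let ?W = "grown (\<lambda>_. [False]) V"
  have far': "\<bar>f e - F\<bar> \<le> real (tdist e v)" if "e \<in> L - V" "v \<in> V" for e v
    using bspec[OF bspec[OF far that(1)] that(2)] by linarith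
  have W: "?W = {v @ [b] |v b. v \<in> V \<and> b \<in> {False}}" by (auto simp: grown_def)
  obtain s' where "live_state H (S \<union> ?W) (L - V \<union> ?W) s' \<and>
           card (S \<union> ?W) \<le> card S + card V * card {False} \<and>
           potential s f \<le> potential s' (\<lambda>x. if x \<in> L - V then f x else F - 1)"
    using edge[OF st V _ _ _ far' W] F lip by auto
  then show "\<exists>S' s' p. (\<forall>v\<in>V. length (p v) = 1) \<and> live_state H S' (L - V \<union> grown p V) s' \<and>
        card S' \<le> card S + card V * 1 \<and>
        potential s f \<le> potential s' (\<lambda>x. if x \<in> L - V then f x else F - 1)"
    by (intro exI[of _ "S \<union> ?W"] exI[of _ s'] exI[of _ "\<lambda>_. [False]"]) simp
qed

lemma gadget_Nil: "gadget 0 0 0"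
  unfolding gadget_def
proof (intro allI impI)
  fix H S L s V f and F :: real
  assume st: "live_state H S L s" and V: "V \<subseteq> L" and F: "\<forall>v\<in>V. f v = F \<and> length v + 0 \<le> H"
  have "L - V \<union> grown (\<lambda>_. []) V = L" using V by (auto simp: grown_def)
  moreover have "potential s f \<le> potential s (\<lambda>x. if x \<in> L - V then f x else F - 0)"
    using F by (intro potential_mono[OF st]) auto
  ultimately show "\<exists>S' s' p. (\<forall>v\<in>V. length (p v) = 0) \<and> live_state H S' (L - V \<union> grown p V) s' \<and>
        card S' \<le> card S + card V * 0 \<and>
        potential s f \<le> potential s' (\<lambda>x. if x \<in> L - V then f x else F - 0)"
    using st by (intro exI[of _ S] exI[of _ s] exI[of _ "\<lambda>_. []"]) simp
qed

lemma gadgetE: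
  assumes "gadget d c N" "live_state H S L s" "V \<subseteq> L" "V \<noteq> {}"
    and "\<And>v. v \<in> V \<Longrightarrow> f v = F" "\<And>v. v \<in> V \<Longrightarrow> length v + d \<le> H"
    and "\<And>x y. x \<in> L - V \<Longrightarrow> y \<in> L - V \<Longrightarrow> f x \<le> f y + real (tdist x y)"
    and "\<And>e v. e \<in> L - V \<Longrightarrow> v \<in> V \<Longrightarrow> \<bar>f e - F\<bar> + 2 * c \<le> real (tdist e v)"
  obtains S' s' p where "\<And>v. v \<in> V \<Longrightarrow> length (p v) = d"
    "live_state H S' (L - V \<union> grown p V) s'" "card S' \<le> card S + card V * N"
    "potential s f \<le> potential s' (\<lambda>x. if x \<in> L - V then f x else F - c)"
proof -
  have "\<exists>S' s' p. (\<forall>v\<in>V. length (p v) = d) \<and> live_state H S' (L - V \<union> grown p V) s' \<and>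
        card S' \<le> card S + card V * N \<and>
        potential s f \<le> potential s' (\<lambda>x. if x \<in> L - V then f x else F - c)"
    by (rule assms(1)[unfolded gadget_def, rule_format, OF assms(2-4)]) (use assms in blast)+
  then show thesis using that by blast
qed

lemma live_state_finite: "live_state H S L s \<Longrightarrow> V \<subseteq> L \<Longrightarrow> finite V"
  by (meson finite_subset live_state_def)

lemma live_state_grown_disjoint:
  assumes "live_state H S L s" "V \<subseteq> L"
  shows "(L - V) \<inter> grown p V = {}"
proof (rule ccontr)
  assume "(L - V) \<inter> grown p V \<noteq> {}"
  then obtain v where v: "v \<in> V" "v @ p v \<in> L - V" by (auto simp: grown_def)
  then have "v = v @ p v"
    using live_state_antichain[OF assms(1), of v "v @ p v"] assms(2) by auto
  then show False using v by auto
qed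

text \<open>The second gadget starts with the value \<open>F - c1\<close>. This shifts the
  differences to the other leaves by at most \<open>c1\<close>, which the reserve
  \<open>2 * (c1 + c2)\<close> covers, since distances do not shrink when leaves are
  extended.\<close>

lemma gadget_seq:
  assumes g1: "gadget d1 c1 N1" and g2: "gadget d2 c2 N2" and c: "0 \<le> c1" "0 \<le> c2"
  shows "gadget (d1 + d2) (c1 + c2) (N1 + N2)"
  unfolding gadget_def
proof (intro allI impI)
  fix H S L s V f and F :: real
  assume st: "live_state H S L s" and V: "V \<subseteq> L" "V \<noteq> {}"
    and F: "\<forall>v\<in>V. f v = F \<and> length v + (d1 + d2) \<le> H"
    and lip: "\<forall>x\<in>L-V. \<forall>y\<in>L-V. f x \<le> f y + real (tdist x y)"
    and far: "\<forall>e\<in>L-V. \<forall>v\<in>V. \<bar>f e - F\<bar> + 2 * (c1 + c2) \<le> real (tdist e v)"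
  have far1: "\<bar>f e - F\<bar> + 2 * c1 \<le> real (tdist e v)" if "e \<in> L - V" "v \<in> V" for e v
    by (rule order_trans[OF _ bspec[OF bspec[OF far that(1)] that(2)]]) (use c in simp)
  obtain S1 s1 p where 1: "\<And>v. v \<in> V \<Longrightarrow> length (p v) = d1"
    "live_state H S1 (L - V \<union> grown p V) s1" "card S1 \<le> card S + card V * N1"
    "potential s f \<le> potential s1 (\<lambda>x. if x \<in> L - V then f x else F - c1)"
    by (rule gadgetE[OF g1 st V _ _ _ far1]) (use F lip in auto)
  let ?V = "grown p V" let ?f = "\<lambda>x. if x \<in> L - V then f x else F - c1"
  have disj: "(L - V) \<inter> ?V = {}" by (rule live_state_grown_disjoint[OF st V(1)])
  then have rest: "L - V \<union> ?V - ?V = L - V" by auto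
  obtain S2 s2 q where 2: "\<And>v. v \<in> ?V \<Longrightarrow> length (q v) = d2"
    "live_state H S2 (L - V \<union> ?V - ?V \<union> grown q ?V) s2" "card S2 \<le> card S1 + card ?V * N2"
    "potential s1 ?f \<le> potential s2 (\<lambda>x. if x \<in> L - V \<union> ?V - ?V then ?f x else F - c1 - c2)"
  proof (rule gadgetE[OF g2 1(2), where V = ?V and f = ?f and F = "F - c1"])
    show "?V \<noteq> {}" using V by (auto simp: grown_def)
    show "?f v = F - c1" if "v \<in> ?V" for v using that disj by auto
    show "length v + d2 \<le> H" if "v \<in> ?V" for v
      using that F 1(1) by (auto simp: grown_def)
    show "?f x \<le> ?f y + real (tdist x y)"
      if "x \<in> L - V \<union> ?V - ?V" "y \<in> L - V \<union> ?V - ?V" for x y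
      using that lip unfolding rest by simp
    show "\<bar>?f e - (F - c1)\<bar> + 2 * c2 \<le> real (tdist e v)"
      if "e \<in> L - V \<union> ?V - ?V" "v \<in> ?V" for e v
    proof -
      have e: "e \<in> L - V" using that rest by blast
      obtain u where u: "v = u @ p u" "u \<in> V" using \<open>v \<in> ?V\<close> by (auto simp: grown_def)
      have "u \<in> L" "e \<noteq> u" "e \<in> L" using u e V by auto
      then have "tdist e v = tdist e u + length (p u)"
        using live_state_tdist_append[OF st] u by blast
      then have "\<bar>f e - F\<bar> + 2 * (c1 + c2) \<le> real (tdist e v)"
        using bspec[OF bspec[OF far e] u(2)] by simp
      then show ?thesis using e c by simp
    qed
  qed auto
  have "card ?V * N2 \<le> card V * N2"
    by (intro mult_right_mono card_grown_le live_state_finite[OF st V(1)]) simp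
  then have "card S2 \<le> card S + card V * (N1 + N2)"
    using 1(3) 2(3) unfolding distrib_left by linarith
  moreover have "potential s f \<le> potential s2 (\<lambda>x. if x \<in> L - V then f x else F - (c1 + c2))"
    using 1(4) 2(4) unfolding rest by (simp add: diff_diff_eq cong: if_cong)
  ultimately show "\<exists>S' s' p. (\<forall>v\<in>V. length (p v) = d1 + d2) \<and>
        live_state H S' (L - V \<union> grown p V) s' \<and>
        card S' \<le> card S + card V * (N1 + N2) \<and>
        potential s f \<le> potential s' (\<lambda>x. if x \<in> L - V then f x else F - (c1 + c2))"
    using 1(1) 2(1,2) unfolding rest
    by (intro exI[of _ S2] exI[of _ s2] exI[of _ "\<lambda>v. p v @ q (v @ p v)"])
      (auto simp: grown_grown, auto simp: grown_def)
qed

lemma gadget_chain: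
  assumes "gadget d c N" "0 < c"
  shows "gadget (n * d) (real n * c) (n * N)"
proof (induction n)
  case 0
  then show ?case using gadget_Nil by simp
next
  case (Suc n)
  have "gadget (n * d + d) (real n * c + c) (n * N + N)"
    using assms by (intro gadget_seq Suc) auto
  then show ?case by (simp add: algebra_simps)
qed

section \<open>Racing arms\<close>

text \<open>\<open>X\<close> and \<open>Y\<close> are the live ends of the left and the right arms of all copies of the gadget, \<open>E\<close>
  contains the other live leaves. The values on the entrances and exits of the gadget are \<open>F\<close> and
  \<open>F - C\<close>, and \<open>c\<close> is the cost of a gadget of the previous level.\<close>

definition racing :: "real \<Rightarrow> nat \<Rightarrow> bool list set \<Rightarrow> bool list set \<Rightarrow> config \<Rightarrow> (bool list \<Rightarrow> real) \<Rightarrow>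
    bool list set \<Rightarrow> bool list set \<Rightarrow> real \<Rightarrow> real \<Rightarrow> real \<Rightarrow> bool" where
  "racing c H S E s f X Y F C val \<longleftrightarrow>
     0 < c \<and> 0 < C \<and> X \<noteq> {} \<and> Y \<noteq> {} \<and> live_state H S (E \<union> X \<union> Y) s \<and>
     (\<forall>z\<in>X \<union> Y. f z = val \<and> (\<forall>e\<in>E. \<bar>f e - F\<bar> + 2 * C \<le> real (tdist e z))) \<and>
     (\<forall>x\<in>E. \<forall>y\<in>E. f x \<le> f y + real (tdist x y)) \<and>
     (\<forall>x\<in>X. \<forall>y\<in>Y. 3 * c \<le> real (tdist x y))"

lemma racing_swap: "racing c H S E s f X Y F C val \<Longrightarrow> racing c H S E s f Y X F C val"
  unfolding racing_def by (simp add: Un_commute Un_left_commute Un_assoc ball_Un) (metis tdist_commute)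

lemma racing_disjoint:
  assumes "racing c H S E s f X Y F C val"
  shows "E \<inter> X = {}" "E \<inter> Y = {}" "X \<inter> Y = {}"
proof -
  have *: "z \<notin> E" if "z \<in> X \<union> Y" for z
  proof
    assume "z \<in> E"
    then have "\<bar>f z - F\<bar> + 2 * C \<le> real (tdist z z)" using assms that unfolding racing_def by blast
    then have "C \<le> 0" by simp
    then show False using assms unfolding racing_def by linarith
  qed
  then show "E \<inter> X = {}" "E \<inter> Y = {}" by auto
  have "z \<notin> Y" if "z \<in> X" for z
  proof
    assume "z \<in> Y"
    then have "3 * c \<le> real (tdist z z)" using assms that unfolding racing_def by blast
    then show False using assms unfolding racing_def by simp
  qed
  then show "X \<inter> Y = {}" by auto
qed

text \<open>The arms \<open>X\<close> are killed and the arms \<open>Y\<close> get \<open>n\<close>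
  further copies. The trip from \<open>X\<close> to \<open>Y\<close> is not charged; it suffices
  that \<open>val\<close> exceeds the exit value \<open>F - C\<close> by at most the cost of these
  copies.\<close>

lemma racing_prune:
  assumes r: "racing c H S E s f X Y F C val" and g: "gadget d c N"
    and n: "real n * c \<le> C" and val: "val \<le> F - C + real n * c"
    and H: "\<And>y. y \<in> Y \<Longrightarrow> length y + n * d \<le> H"
  obtains S' s' q where "\<And>y. y \<in> Y \<Longrightarrow> length (q y) = n * d"
    "live_state H S' (E \<union> grown q Y) s'" "card S' \<le> card S + card Y * (n * N)"
    "potential s f \<le> potential s' (\<lambda>x. if x \<in> E then f x else F - C)"
proof -
  have r': "0 < c" "0 < C" "Y \<noteq> {}" "live_state H S (E \<union> X \<union> Y) s"
    "\<And>z. z \<in> X \<union> Y \<Longrightarrow> f z = val"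
    "\<And>e z. e \<in> E \<Longrightarrow> z \<in> X \<union> Y \<Longrightarrow> \<bar>f e - F\<bar> + 2 * C \<le> real (tdist e z)"
    "\<And>x y. x \<in> E \<Longrightarrow> y \<in> E \<Longrightarrow> f x \<le> f y + real (tdist x y)"
    using r unfolding racing_def by blast+
  define w where "w = F - C + real n * c"
  let ?g = "\<lambda>x. if x \<in> E then f x else w"
  have nc: "0 \<le> real n * c" using r'(1) by simp
  have w: "F - C \<le> w" "w \<le> F" "val \<le> w" using n val nc by (auto simp: w_def)
  have rest: "E \<union> Y - Y = E" using racing_disjoint[OF r] by auto
  have "\<exists>s1. live_state H S (E \<union> Y) s1 \<and> potential s f \<le> potential s1 ?g"
  proof (rule prune[OF r'(4)])
    fix x y assume x: "x \<in> E \<union> X \<union> Y" and y: "y \<in> E \<union> Y"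
    show "f x \<le> ?g y + real (tdist x y)"
    proof (cases "x \<in> E")
      case True
      show ?thesis
      proof (cases "y \<in> E")
        case True
        then show ?thesis using r'(7)[OF \<open>x \<in> E\<close>] by simp
      next
        case False
        then have "\<bar>f x - F\<bar> + 2 * C \<le> real (tdist x y)" using r'(6)[OF True, of y] y by blast
        then show ?thesis unfolding if_not_P[OF False] using w r'(2) by linarith
      qed
    next
      case False
      then have v: "f x = val" using x r'(5) by blast
      show ?thesis
      proof (cases "y \<in> E")
        case True
        have "\<bar>f y - F\<bar> + 2 * C \<le> real (tdist x y)"
          using r'(6)[OF True, of x] x False tdist_commute[of x y] by auto
        then show ?thesis unfolding if_P[OF True] using v w r'(2) by linarith
      next
        case False
        then show ?thesis using v w by simp
      qed
    qed
  qed (use r'(3) in auto)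
  then obtain s1 where s1: "live_state H S (E \<union> Y) s1" "potential s f \<le> potential s1 ?g" by blast
  obtain S' s' q where 2: "\<And>y. y \<in> Y \<Longrightarrow> length (q y) = n * d"
    "live_state H S' (E \<union> Y - Y \<union> grown q Y) s'" "card S' \<le> card S + card Y * (n * N)"
    "potential s1 ?g \<le> potential s' (\<lambda>x. if x \<in> E \<union> Y - Y then ?g x else w - real n * c)"
  proof (rule gadgetE[OF gadget_chain[OF g r'(1)] s1(1), of Y ?g w])
    show "?g v = w" if "v \<in> Y" for v using that racing_disjoint[OF r] by auto
    show "?g x \<le> ?g y + real (tdist x y)"
      if "x \<in> E \<union> Y - Y" "y \<in> E \<union> Y - Y" for x y
      using that r'(7) unfolding rest by simp
    show "\<bar>?g e - w\<bar> + 2 * (real n * c) \<le> real (tdist e v)"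
      if "e \<in> E \<union> Y - Y" "v \<in> Y" for e v
    proof -
      have e: "e \<in> E" using that rest by blast
      have "\<bar>f e - F\<bar> + 2 * C \<le> real (tdist e v)" using r'(6)[OF e] that by blast
      then show ?thesis unfolding if_P[OF e] using n by (simp add: w_def)
    qed
  qed (use r'(3) H in auto)
  have "potential s f \<le> potential s' (\<lambda>x. if x \<in> E then f x else F - C)"
    using s1(2) 2(4) unfolding rest by (simp add: w_def cong: if_cong)
  then show thesis using that 2(1-3) unfolding rest by blast
qed

text \<open>Before the extension the ends \<open>X\<close> are worth \<open>c\<close> more than
  \<open>Y\<close>; the new copy lowers their value by \<open>c\<close>, so both arms end with the
  common value \<open>w\<close>. The distance \<open>3 * c\<close> between the arms is the value
  difference \<open>c\<close> plus the reserve \<open>2 * c\<close> demanded by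
  \<open>gadget\<close>.\<close>

lemma racing_step:
  assumes r: "racing c H S E s f X Y F C val" and g: "gadget d c N"
    and w: "\<bar>F - (w + c)\<bar> + 2 * c \<le> 2 * C" "\<bar>F - w\<bar> \<le> 2 * C"
    and H: "\<And>x. x \<in> X \<Longrightarrow> length x + d \<le> H"
  obtains S' s' f' p where "\<And>x. x \<in> X \<Longrightarrow> length (p x) = d"
    "racing c H S' E s' f' (grown p X) Y F C w" "card S' \<le> card S + card X * N"
    "potential s (\<lambda>x. if x \<in> X then w + c else if x \<in> Y then w else f x) \<le> potential s' f'"
    "\<And>e. e \<in> E \<Longrightarrow> f' e = f e"
proof -
  have r': "0 < c" "0 < C" "Y \<noteq> {}" "X \<noteq> {}" "live_state H S (E \<union> X \<union> Y) s"
    "\<And>z. z \<in> X \<union> Y \<Longrightarrow> f z = val"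
    "\<And>e z. e \<in> E \<Longrightarrow> z \<in> X \<union> Y \<Longrightarrow> \<bar>f e - F\<bar> + 2 * C \<le> real (tdist e z)"
    "\<And>x y. x \<in> E \<Longrightarrow> y \<in> E \<Longrightarrow> f x \<le> f y + real (tdist x y)"
    "\<And>x y. x \<in> X \<Longrightarrow> y \<in> Y \<Longrightarrow> 3 * c \<le> real (tdist x y)"
    using r unfolding racing_def by blast+
  note disj = racing_disjoint[OF r]
  let ?f1 = "\<lambda>x. if x \<in> X then w + c else if x \<in> Y then w else f x"
  have rest: "E \<union> X \<union> Y - X = E \<union> Y" using disj by auto
  have f1E: "?f1 e = f e" if "e \<in> E" for e using that disj by auto
  have f1Y: "?f1 y = w" if "y \<in> Y" for y using that disj by auto
  have EY: "\<bar>f e - w\<bar> \<le> real (tdist e y)" if "e \<in> E" "y \<in> Y" for e y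
  proof -
    have "\<bar>f e - F\<bar> + 2 * C \<le> real (tdist e y)" using r'(7) that by blast
    then show ?thesis using w(2) by linarith
  qed
  obtain S' s' p where 2: "\<And>x. x \<in> X \<Longrightarrow> length (p x) = d"
    "live_state H S' (E \<union> X \<union> Y - X \<union> grown p X) s'" "card S' \<le> card S + card X * N"
    "potential s ?f1 \<le> potential s' (\<lambda>x. if x \<in> E \<union> X \<union> Y - X then ?f1 x else w + c - c)"
  proof (rule gadgetE[OF g r'(5), of X ?f1 "w + c"])
    show "?f1 x \<le> ?f1 y + real (tdist x y)"
      if "x \<in> E \<union> X \<union> Y - X" "y \<in> E \<union> X \<union> Y - X" for x y
    proof -
      consider "x \<in> E" "y \<in> E" | "x \<in> E" "y \<in> Y" | "x \<in> Y" "y \<in> E" | "x \<in> Y" "y \<in> Y"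
        using \<open>x \<in> E \<union> X \<union> Y - X\<close> \<open>y \<in> E \<union> X \<union> Y - X\<close> unfolding rest by blast
      then show ?thesis
      proof cases
        case 1
        show ?thesis unfolding f1E[OF 1(1)] f1E[OF 1(2)] by (rule r'(8)[OF 1])
      next
        case 2
        show ?thesis unfolding f1E[OF 2(1)] f1Y[OF 2(2)] using EY[OF 2] by linarith
      next
        case 3
        show ?thesis unfolding f1E[OF 3(2)] f1Y[OF 3(1)] tdist_commute[of x y]
          using EY[OF 3(2,1)] by linarith
      next
        case 4
        show ?thesis unfolding f1Y[OF 4(1)] f1Y[OF 4(2)] by simp
      qed
    qed
    show "\<bar>?f1 e - (w + c)\<bar> + 2 * c \<le> real (tdist e x)"
      if "e \<in> E \<union> X \<union> Y - X" "x \<in> X" for e x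
    proof -
      consider "e \<in> E" | "e \<in> Y" using \<open>e \<in> E \<union> X \<union> Y - X\<close> rest by blast
      then show ?thesis
      proof cases
        case 1
        have "\<bar>f e - F\<bar> + 2 * C \<le> real (tdist e x)" using r'(7)[OF 1] that by blast
        then show ?thesis unfolding f1E[OF 1] using w(1) by linarith
      next
        case 2
        show ?thesis unfolding f1Y[OF 2]
          using r'(9)[OF \<open>x \<in> X\<close> 2] r'(1) unfolding tdist_commute[of x e] by simp
      qed
    qed
    show "X \<subseteq> E \<union> X \<union> Y" by blast
    show "X \<noteq> {}" by (rule r'(4))
    show "?f1 v = w + c" if "v \<in> X" for v using that by simp
    show "length v + d \<le> H" if "v \<in> X" for v using H that .
  qed (rule that; assumption)
  let ?X = "grown p X" let ?f' = "\<lambda>x. if x \<in> E \<union> Y then ?f1 x else w"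
  have disj': "(E \<union> Y) \<inter> ?X = {}"
    using live_state_grown_disjoint[OF r'(5), of X p] unfolding rest by blast
  have grow_le: "real (tdist z x) \<le> real (tdist z (x @ p x))" if "z \<in> E \<union> Y" "x \<in> X" for z x
  proof -
    have "z \<noteq> x" using that disj by blast
    then have "tdist z (x @ p x) = tdist z x + length (p x)"
      using live_state_tdist_append[OF r'(5)] that by blast
    then show ?thesis by simp
  qed
  have "racing c H S' E s' ?f' ?X Y F C w"
    unfolding racing_def
  proof (intro conjI)
    show "?X \<noteq> {}" using r'(4) by (simp add: grown_def)
    have "E \<union> ?X \<union> Y = E \<union> Y \<union> ?X" by blast
    then show "live_state H S' (E \<union> ?X \<union> Y) s'" using 2(2) unfolding rest by simp
    show "\<forall>z\<in>?X \<union> Y. ?f' z = w \<and> (\<forall>e\<in>E. \<bar>?f' e - F\<bar> + 2 * C \<le> real (tdist e z))"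
    proof (intro ballI conjI)
      fix z assume z: "z \<in> ?X \<union> Y"
      show "?f' z = w" using z disj disj' by auto
      fix e assume e: "e \<in> E"
      have f'e: "?f' e = f e" using e f1E[OF e] by simp
      show "\<bar>?f' e - F\<bar> + 2 * C \<le> real (tdist e z)"
        unfolding f'e
      proof (cases "z \<in> Y")
        case True
        then show "\<bar>f e - F\<bar> + 2 * C \<le> real (tdist e z)" using r'(7)[OF e] by blast
      next
        case False
        then obtain x where x: "x \<in> X" "z = x @ p x" using z by (auto simp: grown_def)
        then have "\<bar>f e - F\<bar> + 2 * C \<le> real (tdist e x)" using r'(7)[OF e] by blast
        then show "\<bar>f e - F\<bar> + 2 * C \<le> real (tdist e z)" using grow_le[of e x] e x by simp
      qed
    qed
    show "\<forall>x\<in>E. \<forall>y\<in>E. ?f' x \<le> ?f' y + real (tdist x y)"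
    proof (intro ballI)
      fix x y assume "x \<in> E" "y \<in> E"
      then show "?f' x \<le> ?f' y + real (tdist x y)" using f1E r'(8) by simp
    qed
    show "\<forall>x\<in>?X. \<forall>y\<in>Y. 3 * c \<le> real (tdist x y)"
    proof (intro ballI)
      fix z y assume z: "z \<in> ?X" and y: "y \<in> Y"
      then obtain x where x: "x \<in> X" "z = x @ p x" by (auto simp: grown_def)
      have "3 * c \<le> real (tdist y x)" using r'(9)[OF x(1) y] by (simp add: tdist_commute)
      then show "3 * c \<le> real (tdist z y)"
        using grow_le[of y x] y x by (simp add: tdist_commute)
    qed
  qed (use r' in auto)
  note racing' = this
  show thesis
  proof (rule that[OF 2(1) racing' 2(3)])
    show "potential s ?f1 \<le> potential s' ?f'"
      using 2(4) unfolding rest add_diff_cancel_right' .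
    show "?f' e = f e" if "e \<in> E" for e using f1E[OF that] that by simp
  qed
qed

text \<open>An equilibrium value, in units of \<open>c\<close>, for arms of \<open>a\<close> and \<open>b\<close> copies when a fair coin
  chooses the arm to extend. Let \<open>D = a - b\<close> and \<open>t = a + b - 2 * a0\<close>. Its excess over \<open>m - (a + b) / 2\<close> is a multiple of the martingale
  \<open>D\<^sup>2 - t\<close> of simple random walk plus a constant, chosen so that at the exit of the walk from
  \<open>\<bar>D\<bar> < r\<close>, \<open>t < 2 * r\<^sup>2\<close> it is at most \<open>\<bar>D\<bar> / 2\<close>.\<close>

definition race_value :: "nat \<Rightarrow> nat \<Rightarrow> nat \<Rightarrow> nat \<Rightarrow> nat \<Rightarrow> real" where
  "race_value m a0 r a b = real m - (real a + real b) / 2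
     + ((real a - real b)\<^sup>2 - (real a + real b - 2 * real a0)) / (4 * real r) + real r / 4"

lemma race_value_commute: "race_value m a0 r a b = race_value m a0 r b a"
  by (simp add: race_value_def power2_commute add.commute)

text \<open>The linear part drops by 1/2 whichever arm grows, which gives the summand 1. The squares
  \<open>(D + 1)\<^sup>2\<close> and \<open>(D - 1)\<^sup>2\<close> exceed \<open>D\<^sup>2\<close>
  by 1 on average, as much as \<open>t\<close> grows.\<close>

lemma race_value_average:
  assumes "1 \<le> r"
  shows "2 * race_value m a0 r a b = race_value m a0 r (Suc a) b + race_value m a0 r a (Suc b) + 1"
  using assms by (simp add: race_value_def field_simps power2_eq_square)

text \<open>The bounds keep the values on both arms within the reserve \<open>2 * C\<close> that
  separates them from the remaining leaves. The summand \<open>r\<close> in \<open>m\<close> makes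
  up for a correction that may be as low as \<open>- r / 4\<close>.\<close>

lemma race_value_bounds:
  assumes "1 \<le> r" "m = a0 + r\<^sup>2 + r" "2 * a0 \<le> a + b" "a + b \<le> 2 * a0 + 2 * r\<^sup>2" "a \<le> b + r" "b \<le> a + r"
  shows "0 \<le> race_value m a0 r a b" "race_value m a0 r a b \<le> real m + real r / 2"
proof -
  define t where "t = real a + real b - 2 * real a0"
  define D where "D = real a - real b"
  have r: "real r > 0" using assms(1) by simp
  have t: "0 \<le> t" "t \<le> 2 * (real r)\<^sup>2"
    using of_nat_mono[OF assms(3), where 'a = real] of_nat_mono[OF assms(4), where 'a = real] by (simp_all add: t_def)
  have "\<bar>D\<bar> \<le> real r"
    using of_nat_mono[OF assms(5), where 'a = real] of_nat_mono[OF assms(6), where 'a = real] by (simp add: D_def)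
  then have D: "D\<^sup>2 \<le> (real r)\<^sup>2" using abs_le_square_iff[of D "real r"] by simp
  have v: "race_value m a0 r a b = (real r)\<^sup>2 + real r - t / 2 + (D\<^sup>2 - t) / (4 * real r) + real r / 4"
    by (simp add: race_value_def t_def D_def assms(2) field_simps)
  have "(D\<^sup>2 - t) / (4 * real r) \<ge> - (real r / 2)"
    using r t D by (simp add: field_simps power2_eq_square) (smt (verit) zero_le_square)
  then show "0 \<le> race_value m a0 r a b" using t r unfolding v by linarith
  have "(D\<^sup>2 - t) / (4 * real r) \<le> real r / 4"
    using r t D by (simp add: field_simps power2_eq_square)
  moreover have "real m = real a0 + (real r)\<^sup>2 + real r" by (simp add: assms(2))
  ultimately show "race_value m a0 r a b \<le> real m + real r / 2" using t r unfolding v by linarith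
qed

text \<open>When the race stops, the promise has to be covered by the \<open>m - b\<close> copies
  still to be grown on the shorter arm.\<close>

lemma race_value_stop:
  assumes "1 \<le> r" "2 * a0 \<le> a + b" "b \<le> a" "a \<le> b + r" "a = b + r \<or> a + b = 2 * a0 + 2 * r\<^sup>2"
  shows "race_value m a0 r a b \<le> real m - real b"
proof -
  define t where "t = real a + real b - 2 * real a0"
  define D where "D = real a - real b"
  have r: "real r > 0" using assms(1) by simp
  have t: "0 \<le> t" using of_nat_mono[OF assms(2), where 'a = real] by (simp add: t_def)
  have D: "0 \<le> D" "D \<le> real r"
    using of_nat_mono[OF assms(3), where 'a = real] of_nat_mono[OF assms(4), where 'a = real] by (simp_all add: D_def)
  have v: "race_value m a0 r a b = real m - real b - D / 2 + (D\<^sup>2 - t) / (4 * real r) + real r / 4"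
    by (simp add: race_value_def t_def D_def field_simps)
  \<comment> \<open>At a lead of \<open>r\<close> the left side is at most \<open>r / 4\<close>; at
    the time limit \<open>t = 2 * r\<^sup>2\<close> it is at most \<open>- r / 4\<close>.\<close>
  have "(D\<^sup>2 - t) / (4 * real r) \<le> D / 2 - real r / 4"
  proof (cases "a = b + r")
    case True
    then have "D = real r" by (simp add: D_def)
    then show ?thesis using r t by (simp add: field_simps power2_eq_square)
  next
    case False
    then have "real (a + b) = real (2 * a0 + 2 * r\<^sup>2)" using assms(5) by simp
    then have "t = 2 * (real r)\<^sup>2" by (simp add: t_def)
    moreover have "D\<^sup>2 \<le> (real r)\<^sup>2" using D by (simp add: power_mono)
    moreover have "0 \<le> D * real r" using D by simp
    ultimately show ?thesis using r by (simp add: field_simps power2_eq_square)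
  qed
  then show ?thesis unfolding v by linarith
qed

text \<open>Induction on \<open>n\<close>, the number of race steps left until the time limit. Each
  step adds one copy with at most \<open>N\<close> edges per gadget; completing the shorter arm, say
  of length \<open>b\<close>, adds \<open>m - b\<close> copies, which fits since the longer arm has
  at most \<open>m\<close>.\<close>

lemma race:
  assumes g: "gadget d c N" and r: "1 \<le> r" and m: "m = a0 + r\<^sup>2 + r"
    and C: "C = 1 + (real m + real r / 4) * c" and V: "finite V"
    and H: "\<And>v. v \<in> V \<Longrightarrow> length v + (1 + m * d) \<le> H"
    and R: "racing c H S E s f (grown p V) (grown q V) F C (F - C + c * race_value m a0 r a b)"
    and p: "\<And>v. v \<in> V \<Longrightarrow> length (p v) = 1 + a * d"
    and q: "\<And>v. v \<in> V \<Longrightarrow> length (q v) = 1 + b * d"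
    and ab: "a + b + n = 2 * a0 + 2 * r\<^sup>2" "2 * a0 \<le> a + b" "a \<le> b + r" "b \<le> a + r"
  shows "\<exists>S' s' q'. (\<forall>v\<in>V. length (q' v) = 1 + m * d) \<and> live_state H S' (E \<union> grown q' V) s' \<and>
           card S' \<le> card S + card V * ((2 * m - (a + b)) * N) \<and>
           potential s f \<le> potential s' (\<lambda>x. if x \<in> E then f x else F - C)"
  using R p q ab
proof (induction n arbitrary: S s f p q a b)
  define concl where "concl = (\<lambda>(S :: bool list set) s f n. \<exists>S' s' q'. (\<forall>v\<in>V. length (q' v) = 1 + m * d) \<and>
     live_state H S' (E \<union> grown q' V) s' \<and> card S' \<le> card S + card V * ((2 * m - n) * N) \<and>
     potential s f \<le> potential s' (\<lambda>x. if x \<in> E then f x else F - C))"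
  define val where "val = (\<lambda>a b. F - C + c * race_value m a0 r a b)"
  have val_commute: "val a b = val b a" for a b
    by (simp add: val_def race_value_commute)
  have r1: "1 \<le> real r" and r2: "1 \<le> (real r)\<^sup>2" using r by simp_all
  have "real m = real a0 + (real r)\<^sup>2 + real r" by (simp add: m)
  then have m2: "2 \<le> real m" using r1 r2 by linarith
  \<comment> \<open>The end of the race: the arm \<open>p\<close>, which is not the shorter one, is
    killed and \<open>q\<close> is completed to \<open>m\<close> copies.\<close>
  have prune_arm: "concl S s f (a + b)"
    if R: "racing c H S E s f (grown p V) (grown q V) F C (val a b)"
      and q: "\<And>v. v \<in> V \<Longrightarrow> length (q v) = 1 + b * d"
      and ab: "2 * a0 \<le> a + b" "b \<le> a" "a \<le> b + r"
        "a = b + r \<or> a + b = 2 * a0 + 2 * r\<^sup>2" "a + b \<le> 2 * a0 + 2 * r\<^sup>2"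
    for S s f p q a b
  proof -
    have c: "0 < c" using R unfolding racing_def by blast
    have am: "a \<le> m" "b \<le> m" using ab m by linarith+
    have C': "real m * c \<le> C" unfolding C using c r1 by (simp add: field_simps)
    have nC: "real (m - b) * c \<le> C"
      by (rule order_trans[OF _ C']) (use c in simp)
    have vC: "val a b \<le> F - C + real (m - b) * c"
      using race_value_stop[OF r ab(1-4), of m] c am by (simp add: val_def of_nat_diff mult.commute)
    have lenH: "length y + (m - b) * d \<le> H" if y: "y \<in> grown q V" for y
    proof -
      obtain v where v: "v \<in> V" "y = v @ q v" using y by (auto simp: grown_def)
      have "m * d = b * d + (m - b) * d" using am(2) by (metis add_mult_distrib le_add_diff_inverse)
      then show ?thesis using H[OF v(1)] v q by simp
    qed
    obtain S' s' q' where 1: "\<And>y. y \<in> grown q V \<Longrightarrow> length (q' y) = (m - b) * d"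
      "live_state H S' (E \<union> grown q' (grown q V)) s'"
      "card S' \<le> card S + card (grown q V) * ((m - b) * N)"
      "potential s f \<le> potential s' (\<lambda>x. if x \<in> E then f x else F - C)"
      by (rule racing_prune[OF R g nC vC lenH]; (assumption | (rule that; assumption)))
    have "card (grown q V) * ((m - b) * N) \<le> card V * ((2 * m - (a + b)) * N)"
      using card_grown_le[OF V] am by (intro mult_mono) auto
    then have "card S' \<le> card S + card V * ((2 * m - (a + b)) * N)" using 1(3) by linarith
    moreover have "length (q v @ q' (v @ q v)) = 1 + m * d" if "v \<in> V" for v
    proof -
      have "m * d = b * d + (m - b) * d" using am(2) by (metis add_mult_distrib le_add_diff_inverse)
      then show ?thesis using 1(1)[of "v @ q v"] q that by (simp add: grown_def)
    qed
    ultimately show ?thesis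
      using 1(2,4) unfolding concl_def grown_grown
      by (intro exI[of _ S'] exI[of _ s'] exI[of _ "\<lambda>v. q v @ q' (v @ q v)"]) simp
  qed
  have extend_arm: "concl S s f (a + b)"
    if IH: "\<And>S s f p. racing c H S E s f (grown p V) (grown q V) F C (val (Suc a) b) \<Longrightarrow>
              (\<And>v. v \<in> V \<Longrightarrow> length (p v) = 1 + Suc a * d) \<Longrightarrow> concl S s f (Suc a + b)"
      and R: "racing c H S E s f (grown p V) (grown q V) F C (val a b)"
      and p: "\<And>v. v \<in> V \<Longrightarrow> length (p v) = 1 + a * d"
      and ab: "2 * a0 \<le> a + b" "a < b + r" "b \<le> a + r" "a + b < 2 * a0 + 2 * r\<^sup>2"
      and pot: "potential s f \<le> potential s (\<lambda>x. if x \<in> grown p V then val (Suc a) b + c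
                  else if x \<in> grown q V then val (Suc a) b else f x)"
    for S s f p q a b
  proof -
    have c: "0 < c" using R unfolding racing_def by blast
    let ?u = "race_value m a0 r (Suc a) b"
    have u: "0 \<le> ?u" "?u \<le> real m + real r / 2"
      using race_value_bounds[OF r m, of "Suc a" b] ab by simp_all
    have cu: "0 \<le> c * ?u" "c * ?u \<le> c * real m + c * real r / 2"
      using u c mult_left_mono[OF u(2), of c] by (simp_all add: distrib_left)
    have cm: "2 * c \<le> c * real m" and cr: "0 \<le> c * real r" using m2 c by simp_all
    have C': "C = 1 + c * real m + c * real r / 4" by (simp add: C algebra_simps)
    \<comment> \<open>Stated for variables \<open>u\<close>, \<open>M\<close>, \<open>R\<close> in
      place of products with \<open>c\<close>, so that the claim is linear.\<close>
    have "\<bar>F - (F - C + u + c)\<bar> + 2 * c \<le> 2 * C \<and> \<bar>F - (F - C + u)\<bar> \<le> 2 * C"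
      if "0 \<le> u" "u \<le> M + R / 2" "2 * c \<le> M" "0 \<le> R" "C = 1 + M + R / 4" for u M R :: real
      using that c by linarith
    from this[OF cu cm cr C']
    have w1: "\<bar>F - (val (Suc a) b + c)\<bar> + 2 * c \<le> 2 * C"
      and w2: "\<bar>F - val (Suc a) b\<bar> \<le> 2 * C"
      by (simp_all add: val_def)
    have am: "Suc a \<le> m" using ab m by linarith
    have lenH: "length x + d \<le> H" if x: "x \<in> grown p V" for x
    proof -
      obtain v where v: "v \<in> V" "x = v @ p v" using x by (auto simp: grown_def)
      have "Suc a * d \<le> m * d" using am by (rule mult_right_mono) simp
      then show ?thesis using H[OF v(1)] v p by simp
    qed
    obtain S1 s1 f1 p1 where 1: "\<And>x. x \<in> grown p V \<Longrightarrow> length (p1 x) = d"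
      "racing c H S1 E s1 f1 (grown p1 (grown p V)) (grown q V) F C (val (Suc a) b)"
      "card S1 \<le> card S + card (grown p V) * N"
      "potential s (\<lambda>x. if x \<in> grown p V then val (Suc a) b + c
          else if x \<in> grown q V then val (Suc a) b else f x) \<le> potential s1 f1"
      "\<And>e. e \<in> E \<Longrightarrow> f1 e = f e"
      by (rule racing_step[OF R g w1 w2 lenH]; (assumption | (rule that; assumption)))
    have "concl S1 s1 f1 (Suc a + b)"
      by (rule IH[OF 1(2)[unfolded grown_grown]]) (use p 1(1) in \<open>auto simp: grown_def\<close>)
    then obtain S2 s2 q2 where 2: "\<forall>v\<in>V. length (q2 v) = 1 + m * d"
      "live_state H S2 (E \<union> grown q2 V) s2"
      "card S2 \<le> card S1 + card V * ((2 * m - (Suc a + b)) * N)"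
      "potential s1 f1 \<le> potential s2 (\<lambda>x. if x \<in> E then f1 x else F - C)"
      unfolding concl_def by blast
    have "card (grown p V) * N \<le> card V * N"
      by (intro mult_right_mono card_grown_le V) simp
    moreover have "2 * m - (a + b) = Suc (2 * m - (Suc a + b))" using ab m by linarith
    then have "card V * ((2 * m - (a + b)) * N) = card V * N + card V * ((2 * m - (Suc a + b)) * N)"
      by (simp add: algebra_simps)
    ultimately have "card S2 \<le> card S + card V * ((2 * m - (a + b)) * N)"
      using 1(3) 2(3) by linarith
    moreover have "potential s f \<le> potential s2 (\<lambda>x. if x \<in> E then f x else F - C)"
      using pot 1(4) 2(4) 1(5) by (simp cong: if_cong)
    ultimately show ?thesis using 2(1,2) unfolding concl_def
      by (intro exI[of _ S2] exI[of _ s2] exI[of _ q2]) simp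
  qed
  \<comment> \<open>The candidates are the values needed before extending the one or the other arm.
    On both arms they add up to \<open>2 * val a b\<close> by
    \<open>race_value_average\<close>.\<close>
  have choose_arm: "potential s f \<le> potential s (\<lambda>x. if x \<in> X then val (Suc a) b + c
                      else if x \<in> Y then val (Suc a) b else f x) \<or>
                    potential s f \<le> potential s (\<lambda>x. if x \<in> Y then val (Suc b) a + c
                      else if x \<in> X then val (Suc b) a else f x)"
    if R: "racing c H S E s f X Y F C (val a b)" for S s f X Y a b
  proof (rule potential_average)
    show "live_state H S (E \<union> X \<union> Y) s" using R unfolding racing_def by blast
    fix x assume x: "x \<in> E \<union> X \<union> Y"
    have "2 * (c * race_value m a0 r a b) =
        c * race_value m a0 r (Suc a) b + c * race_value m a0 r a (Suc b) + c"
      using arg_cong[OF race_value_average[OF r, of m a0 a b], of "(*) c"] by (simp add: algebra_simps)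
    then have "2 * val a b = val (Suc a) b + val (Suc b) a + c"
      unfolding val_commute[of "Suc b" a] by (simp add: val_def)
    moreover have "f x = val a b" if "x \<in> X \<union> Y" using R that unfolding racing_def by blast
    moreover have "0 < c" using R unfolding racing_def by blast
    ultimately show "2 * f x \<le> (if x \<in> X then val (Suc a) b + c
        else if x \<in> Y then val (Suc a) b else f x) + (if x \<in> Y then val (Suc b) a + c
        else if x \<in> X then val (Suc b) a else f x)"
      using x by auto
  qed
  have stop: "concl S s f (a + b)"
    if R: "racing c H S E s f (grown p V) (grown q V) F C (val a b)"
      and p: "\<And>v. v \<in> V \<Longrightarrow> length (p v) = 1 + a * d"
      and q: "\<And>v. v \<in> V \<Longrightarrow> length (q v) = 1 + b * d"
      and ab: "2 * a0 \<le> a + b" "a \<le> b + r" "b \<le> a + r" "a + b \<le> 2 * a0 + 2 * r\<^sup>2"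
      and fin: "a = b + r \<or> b = a + r \<or> a + b = 2 * a0 + 2 * r\<^sup>2"
    for S s f p q a b
  proof (cases "b \<le> a")
    case True
    then show ?thesis using fin r by (intro prune_arm[OF R q]) (use ab in auto)
  next
    case False
    have "concl S s f (b + a)"
    proof (rule prune_arm)
      show "racing c H S E s f (grown q V) (grown p V) F C (val b a)"
        using racing_swap[OF R] val_commute by simp
    qed (use False p ab fin r in auto)
    then show ?thesis by (simp add: add.commute)
  qed
  {
    case 0
    then have "concl S s f (a + b)" by (intro stop[of S s f p q a b]) (auto simp: val_def)
    then show ?case unfolding concl_def .
  next
    case (Suc n)
    have R: "racing c H S E s f (grown p V) (grown q V) F C (val a b)"
      using Suc.prems(1) by (simp add: val_def)
    have IH: "concl S s f (a + b)"
      if "racing c H S E s f (grown p V) (grown q V) F C (val a b)"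
        "\<And>v. v \<in> V \<Longrightarrow> length (p v) = 1 + a * d" "\<And>v. v \<in> V \<Longrightarrow> length (q v) = 1 + b * d"
        "a + b + n = 2 * a0 + 2 * r\<^sup>2" "2 * a0 \<le> a + b" "a \<le> b + r" "b \<le> a + r"
      for S s f p q a b
      unfolding concl_def using Suc.IH[OF that(1)[unfolded val_def] that(2-7)] .
    have "concl S s f (a + b)"
    proof (cases "a = b + r \<or> b = a + r")
      case True
      show ?thesis by (rule stop[OF R]) (use True Suc.prems in auto)
    next
      case False
      from choose_arm[OF R] show ?thesis
      proof
        assume pot: "potential s f \<le> potential s (\<lambda>x. if x \<in> grown p V then val (Suc a) b + c
                  else if x \<in> grown q V then val (Suc a) b else f x)"
        show ?thesis
          by (rule extend_arm[OF IH R Suc.prems(2) _ _ _ _ pot]) (use False Suc.prems in auto)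
      next
        assume pot: "potential s f \<le> potential s (\<lambda>x. if x \<in> grown q V then val (Suc b) a + c
                  else if x \<in> grown p V then val (Suc b) a else f x)"
        have R': "racing c H S E s f (grown q V) (grown p V) F C (val b a)"
          using racing_swap[OF R] val_commute by simp
        have "concl S s f (b + a)"
          by (rule extend_arm[OF IH R' Suc.prems(3) _ _ _ _ pot]) (use False Suc.prems in auto)
        then show ?thesis by (simp add: add.commute)
      qed
    qed
    then show ?case unfolding concl_def .
  }
qed

section \<open>One level of the recursion and the growth of the ratio\<close>

text \<open>A fork below every entrance is followed by \<open>a0\<close> copies grown in parallel on
  both arms, which puts them at least \<open>2 * a0 * d\<close> and hence \<open>3 * c\<close>
  apart; then \<open>race\<close> starts with equal arms. The gain over a plain chain of
  \<open>m\<close> copies is \<open>r / 4 * c\<close>, besides 1 for the fork.\<close>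

lemma gadget_level:
  assumes g: "gadget d c N" and c: "0 < c" and r: "1 \<le> r" and m: "m = a0 + r\<^sup>2 + r"
    and a0: "3 * c \<le> 2 * real a0 * real d"
  shows "gadget (1 + m * d) (1 + (real m + real r / 4) * c) (2 + 2 * m * N)"
  unfolding gadget_def
proof (intro allI impI)
  define C where "C = 1 + (real m + real r / 4) * c"
  fix H S L s V f and F :: real
  assume st: "live_state H S L s" and V: "V \<subseteq> L" "V \<noteq> {}"
    and F: "\<forall>v\<in>V. f v = F \<and> length v + (1 + m * d) \<le> H"
    and lip: "\<forall>x\<in>L-V. \<forall>y\<in>L-V. f x \<le> f y + real (tdist x y)"
    and far0: "\<forall>e\<in>L-V. \<forall>v\<in>V. \<bar>f e - F\<bar> + 2 * (1 + (real m + real r / 4) * c) \<le> real (tdist e v)"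
  define E where "E = L - V"
  have far: "\<bar>f e - F\<bar> + 2 * C \<le> real (tdist e v)" if "e \<in> E" "v \<in> V" for e v
    using far0 that by (simp add: C_def E_def)
  have fin: "finite V" by (rule live_state_finite[OF st V(1)])
  have am: "a0 \<le> m" by (simp add: m)
  have C1: "1 + real a0 * c \<le> C"
  proof -
    have "real a0 * c \<le> real m * c" using am c by (intro mult_right_mono) auto
    moreover have "0 \<le> real r / 4 * c" using c by simp
    ultimately show ?thesis unfolding C_def distrib_right by linarith
  qed
  have a0c: "0 \<le> real a0 * c" using c by simp
  define W where "W = {v @ [b] |v b. v \<in> V \<and> b \<in> (UNIV :: bool set)}"
  have "\<exists>s'. live_state H (S \<union> W) (L - V \<union> W) s' \<and>
           card (S \<union> W) \<le> card S + card V * card (UNIV :: bool set) \<and>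
           potential s f \<le> potential s' (\<lambda>x. if x \<in> L - V then f x else F - 1)"
  proof (rule edge[OF st V _ _ _ _ W_def])
    show "\<bar>f e - F\<bar> \<le> real (tdist e v)" if "e \<in> L - V" "v \<in> V" for e v
      using far[of e v] that C1 a0c by (simp add: E_def)
  qed (use F lip in auto)
  then obtain s1 where s1: "live_state H (S \<union> W) (E \<union> W) s1" "card (S \<union> W) \<le> card S + card V * 2"
    "potential s f \<le> potential s1 (\<lambda>x. if x \<in> E then f x else F - 1)"
    unfolding E_def by auto
  let ?f1 = "\<lambda>x. if x \<in> E then f x else F - 1"
  have EW: "E \<inter> W = {}"
  proof -
    have "L \<subseteq> S" "\<forall>u\<in>L. \<forall>b. u @ [b] \<notin> S" using st unfolding live_state_def by blast+
    then show ?thesis using V(1) unfolding E_def W_def by blast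
  qed
  then have rest: "E \<union> W - W = E" by auto
  have distW: "tdist e (v @ [b]) = tdist e v + 1" if "e \<in> E" "v \<in> V" for e v b
    using live_state_tdist_append[OF st, of e v "[b]"] that V by (auto simp: E_def)
  \<comment> \<open>The gadgets grow on all of \<open>W\<close> at once. The leaves of
    \<open>W\<close> may be close to each other; distance is demanded only from the leaves outside
    \<open>W\<close>.\<close>
  obtain S2 s2 ext where 2: "\<And>w. w \<in> W \<Longrightarrow> length (ext w) = a0 * d"
    "live_state H S2 (E \<union> W - W \<union> grown ext W) s2"
    "card S2 \<le> card (S \<union> W) + card W * (a0 * N)"
    "potential s1 ?f1 \<le> potential s2 (\<lambda>x. if x \<in> E \<union> W - W then ?f1 x else F - 1 - real a0 * c)"
  proof (rule gadgetE[OF gadget_chain[OF g c] s1(1), of W ?f1 "F - 1"])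
    show "W \<subseteq> E \<union> W" by blast
    show "W \<noteq> {}" using V by (auto simp: W_def)
    show "?f1 v = F - 1" if "v \<in> W" for v using that EW by auto
    show "length w + a0 * d \<le> H" if w: "w \<in> W" for w
    proof -
      obtain v b where v: "v \<in> V" "w = v @ [b]" using w by (auto simp: W_def)
      have "a0 * d \<le> m * d" using am by (rule mult_right_mono) simp
      moreover have "length v + (1 + m * d) \<le> H" using F v(1) by blast
      ultimately show ?thesis unfolding v(2) length_append_singleton by linarith
    qed
    show "?f1 x \<le> ?f1 y + real (tdist x y)" if "x \<in> E \<union> W - W" "y \<in> E \<union> W - W" for x y
    proof -
      have xy: "x \<in> E" "y \<in> E" using that rest by blast+
      then show ?thesis unfolding if_P[OF xy(1)] if_P[OF xy(2)] using lip E_def by blast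
    qed
    show "\<bar>?f1 e - (F - 1)\<bar> + 2 * (real a0 * c) \<le> real (tdist e w)"
      if "e \<in> E \<union> W - W" and w: "w \<in> W" for e w
    proof -
      have e: "e \<in> E" using \<open>e \<in> E \<union> W - W\<close> rest by blast
      obtain v b where v: "v \<in> V" "w = v @ [b]" using w by (auto simp: W_def)
      have "\<bar>f e - F\<bar> + 2 * C \<le> real (tdist e w)"
        using far[OF e v(1)] distW[OF e v(1)] v(2) by simp
      moreover have "\<bar>f e - (F - 1)\<bar> \<le> \<bar>f e - F\<bar> + 1" by linarith
      ultimately show ?thesis unfolding if_P[OF e] using C1 a0c by linarith
    qed
  qed (rule that; assumption)
  define p where "p = (\<lambda>v. [False] @ ext (v @ [False]))"
  define q where "q = (\<lambda>v. [True] @ ext (v @ [True]))"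
  have grownW: "grown ext W = grown p V \<union> grown q V"
  proof -
    have "W = (\<lambda>v. v @ [False]) ` V \<union> (\<lambda>v. v @ [True]) ` V"
      unfolding W_def by (auto simp: image_iff)
    then show ?thesis by (simp add: grown_def p_def q_def image_Un image_image)
  qed
  have inW: "v @ [b] \<in> W" if "v \<in> V" for v b using that by (auto simp: W_def)
  let ?f2 = "\<lambda>x. if x \<in> E then f x else F - 1 - real a0 * c"
  have pot2: "potential s f \<le> potential s2 ?f2"
    using s1(3) 2(4) unfolding rest by (simp cong: if_cong)
  have disj2: "E \<inter> grown ext W = {}"
    using live_state_grown_disjoint[OF s1(1), of W ext] unfolding rest by blast
  have "racing c H S2 E s2 ?f2 (grown p V) (grown q V) F C (F - C + c * race_value m a0 r a0 a0)"
    unfolding racing_def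
  proof (intro conjI)
    show "grown p V \<noteq> {}" "grown q V \<noteq> {}" using V by (simp_all add: grown_def)
    show "live_state H S2 (E \<union> grown p V \<union> grown q V) s2"
      using 2(2) unfolding rest grownW Un_assoc .
    \<comment> \<open>With equal arms \<open>race_value\<close> is \<open>m - a0 + r / 4\<close>.
      This determines \<open>C\<close>, as 1 and \<open>a0 * c\<close> have been paid so
      far.\<close>
    have val: "F - C + c * race_value m a0 r a0 a0 = F - 1 - real a0 * c"
      by (simp add: C_def race_value_def algebra_simps)
    show "\<forall>z\<in>grown p V \<union> grown q V. ?f2 z = F - C + c * race_value m a0 r a0 a0 \<and>
        (\<forall>e\<in>E. \<bar>?f2 e - F\<bar> + 2 * C \<le> real (tdist e z))"
      unfolding grownW[symmetric] val
    proof (intro ballI conjI)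
      fix z assume z: "z \<in> grown ext W"
      then show "?f2 z = F - 1 - real a0 * c" using disj2 by auto
      fix e assume e: "e \<in> E"
      obtain u where u: "u \<in> W" "z = u @ ext u" using z by (auto simp: grown_def)
      obtain v b where b: "v \<in> V" "u = v @ [b]" using u(1) by (auto simp: W_def)
      have v: "v \<in> V" "z = (v @ [b]) @ ext (v @ [b])" using b u(2) by simp_all
      have "e \<noteq> v @ [b]" using e EW inW[OF v(1)] by blast
      then have "tdist e z = tdist e (v @ [b]) + length (ext (v @ [b]))"
        unfolding v(2) using live_state_tdist_append[OF s1(1)] e inW[OF v(1)] by blast
      then show "\<bar>?f2 e - F\<bar> + 2 * C \<le> real (tdist e z)"
        using far[OF e v(1)] distW[OF e v(1)] e by simp
    qed
    show "\<forall>x\<in>E. \<forall>y\<in>E. ?f2 x \<le> ?f2 y + real (tdist x y)" using lip by (simp add: E_def)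
    show "\<forall>x\<in>grown p V. \<forall>y\<in>grown q V. 3 * c \<le> real (tdist x y)"
    proof (intro ballI)
      fix x y assume "x \<in> grown p V" "y \<in> grown q V"
      then obtain v u where "v \<in> V" "x = v @ p v" and "u \<in> V" "y = u @ q u"
        by (auto simp: grown_def)
      then have v: "v \<in> V" "x = (v @ [False]) @ ext (v @ [False])"
        and u: "u \<in> V" "y = (u @ [True]) @ ext (u @ [True])"
        by (simp_all add: p_def q_def)
      have "tdist x y = tdist (v @ [False]) (u @ [True])
          + length (ext (v @ [False])) + length (ext (u @ [True]))"
        unfolding v(2) u(2) by (rule live_state_tdist_append2[OF s1(1)]) (use inW v(1) u(1) in auto)
      then have "tdist x y \<ge> 2 * a0 * d" using 2(1) inW v(1) u(1) by simp
      then have "real (tdist x y) \<ge> real (2 * a0 * d)" by (rule of_nat_mono)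
      then show "3 * c \<le> real (tdist x y)" using a0 by simp
    qed
    show "0 < c" "0 < C" using c C1 a0c by linarith+
  qed
  then have "\<exists>S' s' q'. (\<forall>v\<in>V. length (q' v) = 1 + m * d) \<and>
      live_state H S' (E \<union> grown q' V) s' \<and>
      card S' \<le> card S2 + card V * ((2 * m - (a0 + a0)) * N) \<and>
      potential s2 ?f2 \<le> potential s' (\<lambda>x. if x \<in> E then ?f2 x else F - C)"
  proof (rule race[OF g r m C_def fin, rotated])
    show "length (p v) = 1 + a0 * d" "length (q v) = 1 + a0 * d" if "v \<in> V" for v
      using 2(1)[OF inW[OF that]] by (simp_all add: p_def q_def)
    show "a0 + a0 + 2 * r\<^sup>2 = 2 * a0 + 2 * r\<^sup>2" "2 * a0 \<le> a0 + a0" "a0 \<le> a0 + r" "a0 \<le> a0 + r"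
      by simp_all
    show "length v + (1 + m * d) \<le> H" if "v \<in> V" for v using F that by blast
  qed
  then obtain S3 s3 e3 where 3: "\<forall>v\<in>V. length (e3 v) = 1 + m * d" "live_state H S3 (E \<union> grown e3 V) s3"
    "card S3 \<le> card S2 + card V * ((2 * m - (a0 + a0)) * N)"
    "potential s2 ?f2 \<le> potential s3 (\<lambda>x. if x \<in> E then ?f2 x else F - C)"
    by blast
  have "potential s f \<le> potential s3 (\<lambda>x. if x \<in> L - V then f x else F - C)"
    using pot2 3(4) unfolding E_def[symmetric] by (simp cong: if_cong)
  moreover have "card S3 \<le> card S + card V * (2 + 2 * m * N)"
  proof -
    have "W = (\<lambda>(v, b). v @ [b]) ` (V \<times> UNIV)" by (auto simp: W_def)
    then have "card W \<le> card V * 2"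
      using card_image_le[of "V \<times> (UNIV :: bool set)" "\<lambda>(v, b). v @ [b]"] fin
      by (simp add: card_cartesian_product)
    then have "card W * (a0 * N) \<le> card V * 2 * (a0 * N)" by (rule mult_right_mono) simp
    moreover have "2 * m * N = 2 * a0 * N + (2 * m - (a0 + a0)) * N"
      using am by (simp add: add_mult_distrib[symmetric])
    then have "card V * (2 + 2 * m * N) =
        card V * 2 + card V * 2 * (a0 * N) + card V * ((2 * m - (a0 + a0)) * N)"
      by (simp only: distrib_left mult.assoc mult.left_commute)
    ultimately show ?thesis using s1(2) 2(3) 3(3) by linarith
  qed
  ultimately show "\<exists>S' s' p. (\<forall>v\<in>V. length (p v) = 1 + m * d) \<and>
        live_state H S' (L - V \<union> grown p V) s' \<and> card S' \<le> card S + card V * (2 + 2 * m * N) \<and>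
        potential s f \<le> potential s' (\<lambda>x. if x \<in> L - V then f x
                                       else F - (1 + (real m + real r / 4) * c))"
    using 3(1,2) unfolding E_def C_def
    by (intro exI[of _ S3] exI[of _ s3] exI[of _ e3]) simp
qed

text \<open>One level turns a ratio \<open>x\<^sup>2 = c / d\<close> into \<open>x\<^sup>2 + x / 274\<close>, so its square root
  grows linearly in the number of levels.\<close>

lemma gadget_ratio:
  "\<exists>d c N. gadget d c N \<and> 0 < c \<and> 1 \<le> d \<and> (1 + real w / 822)\<^sup>2 * real d \<le> c \<and> N \<le> 2 ^ w * d"
proof (induction w)
  case 0
  show ?case using gadget_edge by (intro exI[of _ 1] conjI) simp_all
next
  case (Suc w)
  then obtain d c N where g: "gadget d c N" and c: "0 < c" and d: "1 \<le> d"
    and ratio: "(1 + real w / 822)\<^sup>2 * real d \<le> c" and N: "N \<le> 2 ^ w * d"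
    by blast
  define y where "y = 1 + real w / 822"
  define x where "x = sqrt (c / real d)"
  \<comment> \<open>An integer within a factor 2 of \<open>x\<close>; the parameters are
    \<open>a0 = 2 * k'\<^sup>2\<close> and \<open>r = 16 * k'\<close>.\<close>
  define k' where "k' = nat \<lceil>x\<rceil>"
  have d': "1 \<le> real d" using d by simp
  have x2: "x\<^sup>2 = c / real d" using c by (simp add: x_def)
  then have cx: "c = x\<^sup>2 * real d" using d' by simp
  have y1: "1 \<le> y" by (simp add: y_def)
  have "y\<^sup>2 \<le> x\<^sup>2" using ratio d' by (simp add: x2 y_def pos_le_divide_eq)
  moreover have "0 \<le> x" using c by (simp add: x_def)
  ultimately have yx: "y \<le> x" by (rule power2_le_imp_le)
  have x1: "1 \<le> x" using yx y1 by linarith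
  have "real k' = of_int \<lceil>x\<rceil>" using x1 by (simp add: k'_def)
  then have k': "x \<le> real k'" "real k' \<le> 2 * x" using x1 of_int_ceiling_le_add_one[of x] by linarith+
  define P where "P = real k'"
  have P: "x \<le> P" "P \<le> 2 * x" using k' by (simp_all add: P_def)
  \<comment> \<open>As \<open>k' \<ge> 1\<close>, this is at most \<open>274 * k'\<^sup>2\<close>,
    where \<open>274 = 2 + 256 + 16\<close>.\<close>
  define m where "m = 2 * k'\<^sup>2 + (16 * k')\<^sup>2 + 16 * k'"
  have r1: "1 \<le> 16 * k'" using P x1 by (simp add: P_def)
  have a0: "3 * c \<le> 2 * real (2 * k'\<^sup>2) * real d"
  proof -
    have "x\<^sup>2 \<le> P\<^sup>2" using P x1 by (intro power_mono) auto
    then have "x\<^sup>2 * real d \<le> P\<^sup>2 * real d" using d' by (intro mult_right_mono) auto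
    moreover have "0 \<le> P\<^sup>2 * real d" by simp
    moreover have "2 * real (2 * k'\<^sup>2) * real d = 4 * (P\<^sup>2 * real d)" by (simp add: P_def)
    ultimately show ?thesis unfolding cx by linarith
  qed
  have g': "gadget (1 + m * d) (1 + (real m + real (16 * k') / 4) * c) (2 + 2 * m * N)"
    by (rule gadget_level[OF g c r1 m_def a0])
  \<comment> \<open>Since \<open>822 = 3 * 274\<close>, two thirds of \<open>x / 274\<close> cover
    the cross term and the rest covers the square of \<open>1 / 822\<close>.\<close>
  have "(1 + real (Suc w) / 822)\<^sup>2 \<le> x\<^sup>2 + x / 274"
  proof -
    have "1 + real (Suc w) / 822 = y + 1 / 822" by (simp add: y_def field_simps)
    moreover have "(y + 1 / 822)\<^sup>2 \<le> (x + 1 / 822)\<^sup>2" using yx y1 by (intro power_mono) auto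
    moreover have "(x + 1 / 822)\<^sup>2 \<le> x\<^sup>2 + x / 274" using x1 by (simp add: power2_eq_square algebra_simps)
    ultimately show ?thesis by simp
  qed
  then have "(1 + real (Suc w) / 822)\<^sup>2 * real (1 + m * d) \<le> (x\<^sup>2 + x / 274) * real (1 + m * d)"
    by (rule mult_right_mono) simp
  \<comment> \<open>The gain \<open>r / 4 * c\<close> equals \<open>4 * (P * Q) * real d\<close>.
    One half pays for the increase of the ratio over depth \<open>m * d\<close>, the other half for
    the additional depth 1 of the fork.\<close>
  also have "\<dots> \<le> 1 + (real m + real (16 * k') / 4) * c"
  proof -
    define Q where "Q = x * x"
    have "1 * P \<le> P * P" using P x1 by (intro mult_right_mono) auto
    then have "real m \<le> 274 * (P * P)" by (simp add: m_def P_def power2_eq_square)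
    also have "P * P \<le> (2 * x) * P" using P x1 by (intro mult_right_mono) auto
    finally have "real m * x \<le> (548 * x * P) * x" using x1 by (intro mult_right_mono) auto
    then have "real m * x / 274 \<le> 2 * (P * Q)" by (simp add: Q_def algebra_simps)
    then have "(real m * x / 274) * real d \<le> 2 * (P * Q) * real d" using d' by (intro mult_right_mono) auto
    moreover have "Q + x / 274 \<le> 2 * (P * Q) * real d"
    proof -
      have "1 * x \<le> Q" unfolding Q_def using x1 by (intro mult_right_mono) auto
      moreover have "1 * Q \<le> P * Q" using P x1 by (intro mult_right_mono) (auto simp: Q_def)
      moreover have "2 * (P * Q) * 1 \<le> 2 * (P * Q) * real d"
        using d' P x1 by (intro mult_left_mono) (auto simp: Q_def)
      ultimately show ?thesis using x1 by linarith
    qed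
    moreover have "(x\<^sup>2 + x / 274) * real (1 + m * d) =
        Q + x / 274 + real m * (Q * real d) + (real m * x / 274) * real d"
      by (simp add: Q_def power2_eq_square algebra_simps)
    moreover have "1 + (real m + real (16 * k') / 4) * c = 1 + real m * (Q * real d) + 4 * (P * Q) * real d"
      by (simp add: cx Q_def P_def power2_eq_square algebra_simps)
    ultimately show ?thesis by linarith
  qed
  finally have "(1 + real (Suc w) / 822)\<^sup>2 * real (1 + m * d) \<le> 1 + (real m + real (16 * k') / 4) * c" .
  moreover have "2 + 2 * m * N \<le> 2 ^ Suc w * (1 + m * d)"
  proof -
    have "m * N \<le> m * (2 ^ w * d)" using N by (rule mult_left_mono) simp
    moreover have "1 \<le> (2 :: nat) ^ w" by simp
    moreover have "2 ^ Suc w * (1 + m * d) = 2 * 2 ^ w + 2 * (m * (2 ^ w * d))"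
      by (simp add: algebra_simps)
    moreover have "2 * m * N = 2 * (m * N)" by simp
    ultimately show ?thesis by linarith
  qed
  moreover have "0 < 1 + (real m + real (16 * k') / 4) * c" using c by (intro add_pos_nonneg) auto
  moreover have "1 \<le> 1 + m * d" by simp
  ultimately show ?case using g' by blast
qed

section \<open>From gadgets to trees that need many moves\<close>

text \<open>A gadget is grown below the root alone. With entrance value \<open>c\<close> and exit
  value 0, the initial potential \<open>k * c\<close> turns into moves, and the exit leaf is still
  unvisited after them.\<close>

lemma expensive_tree:
  assumes "gadget d c N" "0 < c"
  obtains T where "rooted_tree T" "card (nodes T) \<le> 1 + N" "depth T \<le> d"
    "\<And>M. explores_within A k T M \<Longrightarrow> real k * c \<le> M"
proof -
  have st: "live_state d {[]} {[]} ([], \<lambda>_. to_nat ([] :: bool list))"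
    using reachable.init[of A k "word_tree {[]}"]
    by (auto simp: live_state_def prefix_closed_def visited_def word_tree_def)
  obtain S s p where 1: "\<And>v. v \<in> {[]} \<Longrightarrow> length (p v) = d"
    "live_state d S ({[]} - {[]} \<union> grown p {[]}) s" "card S \<le> card {[] :: bool list} + card {[] :: bool list} * N"
    "potential ([], \<lambda>_. to_nat ([] :: bool list)) (\<lambda>_. c) \<le>
       potential s (\<lambda>x. if x \<in> {[]} - {[]} then c else c - c)"
    by (rule gadgetE[OF assms(1) st, of "{[]}" "\<lambda>_. c" c]; ((rule that; assumption) | simp))
  have S: "finite S" "prefix_closed S" "\<And>u. u \<in> S \<Longrightarrow> length u \<le> d" "p [] \<in> S"
    "reachable A k (word_tree S) s" "visited s \<subseteq> to_nat ` (S - {p []})"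
    using 1(2) by (auto simp: live_state_def grown_def)
  have len: "real k * c \<le> real (length (fst s))" using 1(4) by (simp add: potential_def)
  show thesis
  proof
    show "rooted_tree (word_tree S)" by (rule rooted_tree_word_tree[OF S(1,2)])
    show "card (nodes (word_tree S)) \<le> 1 + N" using 1(3) by (simp add: card_word_tree)
    show "depth (word_tree S) \<le> d" by (rule depth_word_tree_le[OF S(1-3)])
    fix M assume M: "explores_within A k (word_tree S) M"
    have "adversary_for k (\<lambda>_. 0)" using k_pos by (simp add: adversary_for_def)
    then obtain adv where adv: "adversary_for k adv" "run A (word_tree S) adv (length (fst s)) = s"
      using reachable_imp_run[OF S(5)] by blast
    obtain t where t: "real t \<le> M" "nodes (word_tree S) \<subseteq> visited (run A (word_tree S) adv t)"
      using M adv(1) unfolding explores_within_def by blast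
    have "length (fst s) < t"
    proof (rule ccontr)
      assume "\<not> ?thesis"
      then have "nodes (word_tree S) \<subseteq> visited s"
        using t(2) visited_run_mono[of t "length (fst s)" A "word_tree S" adv] adv(2) by auto
      then have "to_nat (p []) \<in> to_nat ` (S - {p []})"
        using S(4,6) by (auto simp: word_tree_def)
      then show False by auto
    qed
    then show "real k * c \<le> M" using len t(1) by linarith
  qed
qed

end

section \<open>The number of levels for \<open>k\<close> agents\<close>

theorem theorem4:
  fixes c :: "nat \<Rightarrow> real"
  assumes "\<And>k. c k \<ge> 0"
    and "\<exists>C::real. \<forall>k\<ge>1. \<exists>A. legal A \<and>
           (\<forall>T. rooted_tree T \<longrightarrow>
              explores_within A k T
                (C * (c k * (real (card (nodes T)) + real k * real (depth T)))))"
  shows "c \<in> \<Omega>(\<lambda>k. (ln (real k))\<^sup>2)"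
proof -
  obtain C where C: "\<And>k. k \<ge> 1 \<Longrightarrow> \<exists>A. legal A \<and> (\<forall>T. rooted_tree T \<longrightarrow>
      explores_within A k T (C * (c k * (real (card (nodes T)) + real k * real (depth T)))))"
    using assms(2) by blast
  \<comment> \<open>The factor 3 stems from \<open>n + k * D \<le> 3 * k * d\<close>, the square of
    822 from \<open>gadget_ratio\<close>, and \<open>max C 1\<close> is used because
    \<open>C\<close> may fail to be positive.\<close>
  define K where "K = 3 * 822\<^sup>2 * max C 1"
  have K: "0 < K" by (simp add: K_def)
  have bound: "(ln (real k))\<^sup>2 \<le> K * c k" if k: "k \<ge> 1" for k
  proof -
    obtain A where A: "legal A" "\<And>T. rooted_tree T \<Longrightarrow>
      explores_within A k T (C * (c k * (real (card (nodes T)) + real k * real (depth T))))"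
      using C[OF k] by blast
    interpret explorer A k
    proof
      show "\<exists>t. nodes T \<subseteq> visited (run A T adv t)" if "rooted_tree T" "adversary_for k adv" for T adv
        using A(2)[OF that(1)] that(2) unfolding explores_within_def by blast
    qed (use A k in auto)
    \<comment> \<open>With \<open>w\<close> the binary logarithm of \<open>k\<close>, rounded down,
      the tree has at most \<open>1 + k * d\<close> nodes, so \<open>n + k * D\<close> stays of
      order \<open>k * d\<close>.\<close>
    obtain w where w: "2 ^ w \<le> k" "k < 2 ^ (w + 1)"
      using ex_power_ivl1[of 2 k] k by auto
    obtain d c' N where g: "gadget d c' N" "0 < c'" "1 \<le> d"
      "(1 + real w / 822)\<^sup>2 * real d \<le> c'" "N \<le> 2 ^ w * d"
      using gadget_ratio by blast
    obtain T where T: "rooted_tree T" "card (nodes T) \<le> 1 + N" "depth T \<le> d"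
      "\<And>M. explores_within A k T M \<Longrightarrow> real k * c' \<le> M"
      using expensive_tree[OF g(1,2)] by blast
    have kd: "real k * real d > 0" using k g(3) by simp
    have "N \<le> k * d" using g(5) w(1) by (meson mult_le_mono1 order_trans)
    moreover have "1 \<le> k * d" using k g(3) by simp
    moreover have "k * depth T \<le> k * d" using T(3) by simp
    ultimately have "card (nodes T) + k * depth T \<le> 3 * (k * d)" using T(2) by linarith
    then have "real (card (nodes T) + k * depth T) \<le> real (3 * (k * d))" by (rule of_nat_mono)
    then have size: "real (card (nodes T)) + real k * real (depth T) \<le> 3 * (real k * real d)" by simp
    have "(1 + real w / 822)\<^sup>2 * (real k * real d) \<le> real k * c'"
      using mult_left_mono[OF g(4), of "real k"] by (simp add: algebra_simps)
    also have "\<dots> \<le> C * (c k * (real (card (nodes T)) + real k * real (depth T)))"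
      using T(4) A(2) T(1) by blast
    also have "\<dots> \<le> max C 1 * (c k * (real (card (nodes T)) + real k * real (depth T)))"
      using assms(1)[of k] by (intro mult_right_mono) auto
    also have "\<dots> \<le> max C 1 * (c k * (3 * (real k * real d)))"
      using assms(1)[of k] size by (intro mult_left_mono) auto
    finally have "(1 + real w / 822)\<^sup>2 * (real k * real d) \<le> (3 * max C 1 * c k) * (real k * real d)"
      by (simp add: algebra_simps)
    then have main: "(1 + real w / 822)\<^sup>2 \<le> 3 * max C 1 * c k"
      using kd by (simp only: mult_le_cancel_right_pos)
    have "real k \<le> real (2 ^ (w + 1))" using w(2) by (intro of_nat_mono) simp
    then have "ln (real k) \<le> ln (2 ^ (w + 1))" using k by (subst ln_le_cancel_iff) auto
    also have "\<dots> = real (w + 1) * ln 2" by (rule ln_realpow)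
    also have "\<dots> \<le> real (w + 1) * 1" using ln_2_less_1 by (intro mult_left_mono) auto
    also have "\<dots> \<le> 822 * (1 + real w / 822)" by simp
    finally have "(ln (real k))\<^sup>2 \<le> (822 * (1 + real w / 822))\<^sup>2"
      using k by (intro power_mono) auto
    also have "\<dots> = 822\<^sup>2 * (1 + real w / 822)\<^sup>2" by (simp only: power_mult_distrib)
    also have "\<dots> \<le> 822\<^sup>2 * (3 * max C 1 * c k)" using main by (intro mult_left_mono) auto
    finally show ?thesis by (simp add: K_def algebra_simps)
  qed
  show ?thesis
  proof (rule landau_omega.bigI[of "1 / K"])
    show "1 / K > 0" using K by simp
    show "eventually (\<lambda>k. norm (c k) \<ge> 1 / K * norm ((ln (real k))\<^sup>2)) at_top"
      using eventually_ge_at_top[of 1]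
    proof eventually_elim
      case (elim k)
      then show ?case using bound[OF elim] K assms(1)[of k] by (simp add: field_simps)
    qed
  qed
qed

end
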